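(* Let $\phi$ be a spherically symmetric solution to $\Box_g\phi=0$ on $\mathcal R$ whose initial data satisfy the data bounds with some constant $D>0$ and the limit condition. If for some $u\le-1$ and for some integer $\alpha_0>0$ we have, in the interior of the black hole, $$\int_1^\infty\log^{\alpha_0}\Big(\frac1\Omega\Big)(\partial_v\phi)^2(u,v)\,dv<\infty,$$ then $$\int_{\mathcal H^+\cap\{v\ge1\}}\frac{v^{\alpha_0}}{\log^2(1+v)}(\partial_v\phi)^2<\infty.$$
   Context: Fix $0<|e|<M$, let $r_\pm=M\pm\sqrt{M^2-e^2}$, $F(r)=1-\frac{2M}{r}+\frac{e^2}{r^2}$. On the exterior region $\{r>r_+\}$ and on the black hole interior $\{r_-<r<r_+\}$ the Reissner–Nordström metric is $g=-F\,dt^2+F^{-1}dr^2+r^2d\sigma_{\mathbb S^2}$. Put $r^*=r+\big(M+\frac{2M^2-e^2}{2\sqrt{M^2-e^2}}\big)\log|r-r_+|+\big(M-\frac{2M^2-e^2}{2\sqrt{M^2-e^2}}\big)\log|r-r_-|$. Exterior null coordinates: $v=\frac12(t+r^* )$, $u=\frac12(t-r^* )$, $\Omega^2=F$, $\partial_v r=-\partial_u r=\Omega^2$; the event horizon $\mathcal H^+$ is $\{u=+\infty\}$. Interior null coordinates: $v=\frac12(r^*+t)$, $u=\frac12(r^*-t)$, $\Omega^2=-F$, $\partial_v r=\partial_u r=-\Omega^2$; $\mathcal H^+$ is $\{u=-\infty\}$, the (incoming) future Cauchy horizon is $\{v=\infty\}$. In both regions $g=-4\Omega^2du\,dv+r^2d\sigma_{\mathbb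 S^2}$. The two regions are glued smoothly along $\mathcal H^+=\{r=r_+\}$ using coordinates $(v,r)$, in which $g=-4F\,dv^2+4\,dv\,dr+r^2d\sigma_{\mathbb S^2}$. For spherically symmetric $\phi$, $\Box_g\phi=0$ reads $\partial_u\partial_v\phi=-\frac{\partial_v r\,\partial_u\phi}{r}-\frac{\partial_u r\,\partial_v\phi}{r}$. Solutions are real-valued, $C^1$ (including across $\mathcal H^+$), with continuous $\partial_u\partial_v\phi$. Fix $U_0>0$. $\mathcal R$ is the union of the exterior set $\{u\ge -U_0,\ v\ge1\}$, $\mathcal H^+\cap\{v\ge1\}$, and the interior set $\{u\le-1,\ v\ge1\}$. Data bounds with constant $D$: on the exterior hypersurface $\{u=-U_0,\ v\ge1\}$, $r^2\big|\frac{\partial_v\phi}{\partial_v r}\big|\le D$ and $r^3\big|\frac{\partial_v(r\phi)}{\partial_v r}\big|\le D$; on the hypersurface $\{v=1\}$, restricted to $u\ge -U_0$ in the exterior and $u\le -1$ in the interior, $\big|\frac{\partial_u\phi}{\partial_u r}\big|\le D$ and $\big|\frac{\partial_u(r\phi)}{\partial_u r}\big|\le D$. Limit condition: $\lim_{v\to\infty}r^3\partial_v(r\phi)(-U_0,v)$ exists (exterior). The integral over $\mathcal H^+$ is with respect to $dv$; on $\mathcal H^+$, $\partial_v\phi$ is the limit of the null-coordinate derivative at the horizon. *)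

theory Defs
  imports "HOL-Analysis.Analysis"
begin

text \<open>
  Subextremal Reissner--Nordstrom with mass \<open>M\<close> and charge \<open>e\<close>. A spherically symmetric function
  is a function of the chart \<open>(v, r)\<close>, which is smooth across the event horizon \<open>r = r\<^sub>+\<close>.
\<close>

definition r_plus :: "real \<Rightarrow> real \<Rightarrow> real" where
  "r_plus M e = M + sqrt (M\<^sup>2 - e\<^sup>2)"

definition r_minus :: "real \<Rightarrow> real \<Rightarrow> real" where
  "r_minus M e = M - sqrt (M\<^sup>2 - e\<^sup>2)"

definition rn_F :: "real \<Rightarrow> real \<Rightarrow> real \<Rightarrow> real" where
  "rn_F M e r = 1 - 2 * M / r + e\<^sup>2 / r\<^sup>2"

definition r_star :: "real \<Rightarrow> real \<Rightarrow> real \<Rightarrow> real" where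
  "r_star M e r = r
     + (M + (2 * M\<^sup>2 - e\<^sup>2) / (2 * sqrt (M\<^sup>2 - e\<^sup>2))) * ln \<bar>r - r_plus M e\<bar>
     + (M - (2 * M\<^sup>2 - e\<^sup>2) / (2 * sqrt (M\<^sup>2 - e\<^sup>2))) * ln \<bar>r - r_minus M e\<bar>"

text \<open>
  The area radius as a function of the null coordinates \<open>(u, v)\<close>. In the exterior \<open>r\<^sup>* = v - u\<close>,
  in the interior \<open>r\<^sup>* = v + u\<close>; \<open>r_star\<close> is a bijection onto the reals from each of
  \<open>{r\<^sub>+<..}\<close> (increasing) and \<open>{r\<^sub>-<..<r\<^sub>+}\<close> (decreasing).
\<close>

definition r_ext :: "real \<Rightarrow> real \<Rightarrow> real \<Rightarrow> real \<Rightarrow> real" where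
  "r_ext M e u v = the_inv_into {r_plus M e<..} (r_star M e) (v - u)"

definition r_int :: "real \<Rightarrow> real \<Rightarrow> real \<Rightarrow> real \<Rightarrow> real" where
  "r_int M e u v = the_inv_into {r_minus M e<..<r_plus M e} (r_star M e) (v + u)"

definition Omega_int :: "real \<Rightarrow> real \<Rightarrow> real \<Rightarrow> real \<Rightarrow> real" where
  "Omega_int M e u v = sqrt (- rn_F M e (r_int M e u v))"

text \<open>The region as a set of points \<open>(v, r)\<close>: exterior part, event horizon, interior part.\<close>

definition rn_region :: "real \<Rightarrow> real \<Rightarrow> real \<Rightarrow> (real \<times> real) set" where
  "rn_region M e U0 =
     {(v, r_ext M e u v) | u v. u \<ge> - U0 \<and> v \<ge> 1}
     \<union> {(v, r_plus M e) | v. v \<ge> 1}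
     \<union> {(v, r_int M e u v) | u v. u \<le> -1 \<and> v \<ge> 1}"

definition in_ext :: "real \<Rightarrow> real \<Rightarrow> (real \<times> real \<Rightarrow> real) \<Rightarrow> real \<Rightarrow> real \<Rightarrow> real" where
  "in_ext M e \<phi> u v = \<phi> (v, r_ext M e u v)"

definition in_int :: "real \<Rightarrow> real \<Rightarrow> (real \<times> real \<Rightarrow> real) \<Rightarrow> real \<Rightarrow> real \<Rightarrow> real" where
  "in_int M e \<phi> u v = \<phi> (v, r_int M e u v)"

text \<open>
  Null-coordinate derivatives of functions of \<open>(u, v)\<close> on \<open>I \<times> {1..}\<close>, where \<open>I\<close> is
  \<open>{-U0..}\<close> in the exterior and \<open>{..-1}\<close> in the interior; one-sided at the boundary.
\<close>

definition pd_u :: "real set \<Rightarrow> (real \<Rightarrow> real \<Rightarrow> real) \<Rightarrow> real \<Rightarrow> real \<Rightarrow> real" where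
  "pd_u I f u v = vector_derivative (\<lambda>u'. f u' v) (at u within I)"

definition pd_v :: "(real \<Rightarrow> real \<Rightarrow> real) \<Rightarrow> real \<Rightarrow> real \<Rightarrow> real" where
  "pd_v f u v = vector_derivative (\<lambda>v'. f u v') (at v within {1..})"

definition C1_on :: "'a::real_normed_vector set \<Rightarrow> ('a \<Rightarrow> real) \<Rightarrow> bool" where
  "C1_on S f \<longleftrightarrow> (\<exists>f' :: 'a \<Rightarrow> 'a \<Rightarrow>\<^sub>L real.
     (\<forall>x\<in>S. (f has_derivative blinfun_apply (f' x)) (at x within S)) \<and> continuous_on S f')"

text \<open>
  The wave equation for \<open>f (u, v)\<close> on \<open>I \<times> {1..}\<close> with area radius \<open>r (u, v)\<close>; the first two
  conjuncts say that the mixed derivative exists and is continuous.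
\<close>

definition wave_eq :: "real set \<Rightarrow> (real \<Rightarrow> real \<Rightarrow> real) \<Rightarrow> (real \<Rightarrow> real \<Rightarrow> real) \<Rightarrow> bool" where
  "wave_eq I r f \<longleftrightarrow>
     (\<forall>u\<in>I. \<forall>v\<ge>1. (\<lambda>u'. pd_v f u' v) differentiable (at u within I)) \<and>
     continuous_on (I \<times> {1..}) (\<lambda>(u, v). pd_u I (pd_v f) u v) \<and>
     (\<forall>u\<in>I. \<forall>v\<ge>1. pd_u I (pd_v f) u v =
        - (pd_v r u v * pd_u I f u v) / r u v - (pd_u I r u v * pd_v f u v) / r u v)"

text \<open>
  On the horizon itself the equation (in the chart \<open>(v, r)\<close>) follows by continuity from the
  exterior and interior equations and the \<open>C\<^sup>1\<close> regularity across it.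
\<close>

definition spherical_wave_solution ::
    "real \<Rightarrow> real \<Rightarrow> real \<Rightarrow> (real \<times> real \<Rightarrow> real) \<Rightarrow> bool" where
  "spherical_wave_solution M e U0 \<phi> \<longleftrightarrow>
     C1_on (rn_region M e U0) \<phi> \<and>
     wave_eq {- U0..} (r_ext M e) (in_ext M e \<phi>) \<and>
     wave_eq {..-1} (r_int M e) (in_int M e \<phi>)"

definition times_r :: "(real \<Rightarrow> real \<Rightarrow> real) \<Rightarrow> (real \<Rightarrow> real \<Rightarrow> real) \<Rightarrow> real \<Rightarrow> real \<Rightarrow> real" where
  "times_r r f u v = r u v * f u v"

definition data_bounds ::
    "real \<Rightarrow> real \<Rightarrow> real \<Rightarrow> real \<Rightarrow> (real \<times> real \<Rightarrow> real) \<Rightarrow> bool" where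
  "data_bounds M e U0 D \<phi> \<longleftrightarrow>
     (let r = r_ext M e; f = in_ext M e \<phi>; s = r_int M e; g = in_int M e \<phi> in
       (\<forall>v\<ge>1. (r (- U0) v)\<^sup>2 * \<bar>pd_v f (- U0) v / pd_v r (- U0) v\<bar> \<le> D
            \<and> (r (- U0) v) ^ 3 * \<bar>pd_v (times_r r f) (- U0) v / pd_v r (- U0) v\<bar> \<le> D) \<and>
       (\<forall>u\<ge>- U0. \<bar>pd_u {- U0..} f u 1 / pd_u {- U0..} r u 1\<bar> \<le> D
            \<and> \<bar>pd_u {- U0..} (times_r r f) u 1 / pd_u {- U0..} r u 1\<bar> \<le> D) \<and>
       (\<forall>u\<le>-1. \<bar>pd_u {..-1} g u 1 / pd_u {..-1} s u 1\<bar> \<le> D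
            \<and> \<bar>pd_u {..-1} (times_r s g) u 1 / pd_u {..-1} s u 1\<bar> \<le> D))"

definition limit_condition ::
    "real \<Rightarrow> real \<Rightarrow> real \<Rightarrow> (real \<times> real \<Rightarrow> real) \<Rightarrow> bool" where
  "limit_condition M e U0 \<phi> \<longleftrightarrow>
     (\<exists>L. ((\<lambda>v. (r_ext M e (- U0) v) ^ 3
              * pd_v (times_r (r_ext M e) (in_ext M e \<phi>)) (- U0) v) \<longlongrightarrow> L) at_top)"

text \<open>
  The limit of the null derivative at the event horizon, taken from the exterior (\<open>u \<rightarrow> \<infinity>\<close>).
  For \<open>\<phi>\<close> of class \<open>C\<^sup>1\<close> across the horizon it exists and agrees with the limit \<open>u \<rightarrow> -\<infinity>\<close> from the
  interior: in the chart \<open>(v, r)\<close> the null derivative is \<open>\<partial>\<^sub>v\<phi> + F \<partial>\<^sub>r\<phi>\<close> on both sides.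
\<close>

definition dv_horizon :: "real \<Rightarrow> real \<Rightarrow> (real \<times> real \<Rightarrow> real) \<Rightarrow> real \<Rightarrow> real" where
  "dv_horizon M e \<phi> v = Lim at_top (\<lambda>u. pd_v (in_ext M e \<phi>) u v)"

end

theory Submission
  imports Defs
begin

text \<open>
  In the interior put \<open>x = u + v\<close>, \<open>a = r \<partial>\<^sub>v\<phi>\<close>, \<open>b = r \<partial>\<^sub>u\<phi>\<close> and \<open>c = \<Omega>\<^sup>2 / r\<close>. The wave equation becomes
  \<open>\<partial>\<^sub>u a = c(x) b\<close>, \<open>\<partial>\<^sub>v b = c(x) a\<close>, with \<open>c\<close> decaying exponentially as \<open>x \<rightarrow> \<plusminus>\<infinity>\<close>. Hence
  \<open>\<partial>\<^sub>u(a\<^sup>2) - \<partial>\<^sub>v(b\<^sup>2) = 0\<close>: the problem can be solved from \<open>\<Gamma> = {u = u\<^sub>0} \<union> {v = 1}\<close> backwards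
  in \<open>u\<close> towards the horizon \<open>u = -\<infinity>\<close>, and this evolution has a conserved positive energy. Since \<open>a\<close> and \<open>b\<close>
  interact only near \<open>v = -u\<close>, the energy may be weighted by \<open>(T + v)^n\<close> on \<open>a\<^sup>2\<close> and \<open>(T - u)^n\<close> on
  \<open>b\<^sup>2\<close>: for \<open>T\<close> large, the error is absorbed by extra bounded factors that are monotone in \<open>x\<close>. The
  weighted flux through \<open>u = u\<^sub>0\<close> is finite by hypothesis, because \<open>log (1/\<Omega>)\<close> grows linearly in \<open>v\<close>,
  and that through \<open>v = 1\<close> by the data bound on \<open>\<partial>\<^sub>u\<phi> / \<partial>\<^sub>u r\<close>. Fatou's lemma as \<open>u \<rightarrow> -\<infinity>\<close> gives
  \<open>\<integral> v^n (\<partial>\<^sub>v\<phi>)\<^sup>2 dv < \<infinity>\<close> on the horizon, even without the logarithmic loss.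
\<close>

section \<open>Weighted energy estimate\<close>

text \<open>The inequality \<open>y \<le> exp y\<close> at \<open>y = d * (1 + x)\<close>, raised to
  the power \<open>m\<close>, bounds \<open>(1 + x) ^ m\<close> by a multiple of
  \<open>exp (c * x)\<close>, because \<open>m * d = c\<close>. Taking \<open>m = Suc n\<close>
  keeps the division meaningful for \<open>n = 0\<close>.\<close>

lemma power_exp_bounded:
  fixes c :: real
  assumes "c > 0"
  obtains K where "K > 0" "\<And>x. x \<ge> 0 \<Longrightarrow> (1 + x) ^ n * exp (- c * x) \<le> K"
proof -
  define m where "m = Suc n"
  define d where "d = c / m"
  have d: "d > 0" using assms by (simp add: d_def m_def)
  show thesis
  proof (rule that)
    show "exp c / d ^ m > 0" using d by simp
    fix x :: real assume x: "x \<ge> 0"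
    have "(d * (1 + x)) ^ m \<le> exp (d * (1 + x)) ^ m"
      by (rule power_mono) (use d x in \<open>auto intro: order_trans[OF _ exp_ge_add_one_self]\<close>)
    also have "\<dots> = exp (c * (1 + x))"
      unfolding exp_of_nat_mult[symmetric] by (simp add: d_def m_def)
    also have "\<dots> = exp c * exp (c * x)" by (simp add: exp_add distrib_left)
    finally have "(1 + x) ^ m * d ^ m \<le> exp c * exp (c * x)"
      by (simp add: power_mult_distrib mult.commute)
    moreover have "(1 + x) ^ n * d ^ m \<le> (1 + x) ^ m * d ^ m"
      using d x by (intro mult_right_mono power_increasing) (auto simp: m_def)
    ultimately have "(1 + x) ^ n * d ^ m \<le> exp c * exp (c * x)" by linarith
    then show "(1 + x) ^ n * exp (- c * x) \<le> exp c / d ^ m"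
      using d by (simp add: field_simps exp_minus)
  qed
qed

text \<open>By symmetry let \<open>P\<close> be the larger number and \<open>Q\<close> the smaller;
  then \<open>P - Q \<le> (E - 1) * Q\<close> and \<open>P + Q \<le> 2 * P\<close>. The gain is the
  factor \<open>E - 1\<close> in the second bound, which is small when the two numbers nearly
  agree.\<close>

lemma sum_diff_squares_le:
  fixes X Y E :: real
  assumes "X \<ge> 0" "Y \<ge> 0" "E \<ge> 1" "X \<le> E * Y" "Y \<le> E * X"
  shows "X\<^sup>2 + Y\<^sup>2 \<le> 2 * E * (X * Y)" "\<bar>Y\<^sup>2 - X\<^sup>2\<bar> \<le> 2 * (E - 1) * (X * Y)"
proof -
  have *: "P\<^sup>2 + Q\<^sup>2 \<le> 2 * E * (P * Q) \<and> P\<^sup>2 - Q\<^sup>2 \<le> 2 * (E - 1) * (P * Q)"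
    if "0 \<le> Q" "Q \<le> P" "P \<le> E * Q" for P Q
  proof -
    have 0: "0 \<le> P" using that by linarith
    have 1: "P * P \<le> (E * Q) * P" using that 0 by (intro mult_right_mono) auto
    have 2: "Q * Q \<le> 1 * (P * Q)" using that by (auto intro: mult_right_mono)
    have 3: "1 * (P * Q) \<le> E * (P * Q)" using that 0 assms by (intro mult_right_mono) auto
    have 4: "(P - Q) * (P + Q) \<le> ((E - 1) * Q) * (2 * P)"
      using that 0 by (intro mult_mono) (auto simp: algebra_simps)
    show ?thesis using 1 2 3 4 by (simp add: power2_eq_square algebra_simps)
  qed
  consider "X \<le> Y" | "Y \<le> X" by linarith
  then show "X\<^sup>2 + Y\<^sup>2 \<le> 2 * E * (X * Y)" "\<bar>Y\<^sup>2 - X\<^sup>2\<bar> \<le> 2 * (E - 1) * (X * Y)"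
  proof (atomize(full), cases)
    case 1
    then show "X\<^sup>2 + Y\<^sup>2 \<le> 2 * E * (X * Y) \<and> \<bar>Y\<^sup>2 - X\<^sup>2\<bar> \<le> 2 * (E - 1) * (X * Y)"
      using *[of X Y] assms power_mono[of X Y 2] by (simp add: mult.commute add.commute)
  next
    case 2
    then show "X\<^sup>2 + Y\<^sup>2 \<le> 2 * E * (X * Y) \<and> \<bar>Y\<^sup>2 - X\<^sup>2\<bar> \<le> 2 * (E - 1) * (X * Y)"
      using *[of Y X] assms power_mono[of Y X 2] by (simp add: mult.commute add.commute)
  qed
qed

text \<open>\<open>T + x\<close> is at most \<open>(1 + \<bar>x - y\<bar> / T) * (T + y)\<close>,
  hence at most \<open>exp (\<bar>x - y\<bar> / T) * (T + y)\<close>, and the power turns the rate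
  \<open>1 / T\<close> into \<open>n / T \<le> \<epsilon>\<close>. A large shift \<open>T\<close>
  thus makes the weights at \<open>x\<close> and \<open>y\<close> comparable up to a slow
  exponential of their distance.\<close>

lemma shifted_power_ratio:
  fixes x y T \<epsilon> :: real
  assumes "x \<ge> 0" "y \<ge> 0" "T > 0" "n \<le> \<epsilon> * T" 
  shows "(T + x) ^ n \<le> exp (\<epsilon> * \<bar>x - y\<bar>) * (T + y) ^ n"
proof -
  have "T + x \<le> (1 + \<bar>x - y\<bar> / T) * (T + y)"
  proof -
    have "\<bar>x - y\<bar> / T * T \<le> \<bar>x - y\<bar> / T * (T + y)"
      using assms by (intro mult_left_mono) auto
    then show ?thesis using assms by (simp add: algebra_simps)
  qed
  also have "\<dots> \<le> exp (\<bar>x - y\<bar> / T) * (T + y)"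
    using assms by (intro mult_right_mono) auto
  finally have "(T + x) ^ n \<le> (exp (\<bar>x - y\<bar> / T) * (T + y)) ^ n"
    using assms by (intro power_mono) auto
  also have "\<dots> = exp (n * (\<bar>x - y\<bar> / T)) * (T + y) ^ n"
    by (simp add: power_mult_distrib exp_of_nat_mult[symmetric])
  also have "\<dots> \<le> exp (\<epsilon> * \<bar>x - y\<bar>) * (T + y) ^ n"
  proof -
    have "n * \<bar>x - y\<bar> \<le> (\<epsilon> * T) * \<bar>x - y\<bar>" using assms by (intro mult_right_mono) auto
    then show ?thesis using assms by (intro mult_right_mono) (auto simp: field_simps)
  qed
  finally show ?thesis .
qed

text \<open>\<open>X\<^sup>2\<close> and \<open>Y\<^sup>2\<close> stand for the weights on
  \<open>a\<^sup>2\<close> and \<open>b\<^sup>2\<close>, and \<open>x\<close> for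
  \<open>u + v\<close>. The bracket equals \<open>(X\<^sup>2 + Y\<^sup>2) * h + (Y\<^sup>2 -
  X\<^sup>2) * (2 * H)\<close>. In its second term the difference of squares gains
  \<open>E - 1 \<le> \<epsilon> * \<bar>x\<bar> * E\<close>, and
  \<open>2 * \<epsilon> * H \<le> h\<close> then replaces \<open>H\<close> by \<open>h\<close>. The
  arithmetic-geometric mean inequality separates \<open>a\<close> from \<open>b\<close>, and
  \<open>k\<close> absorbs \<open>c\<close> with the remaining factors.\<close>

lemma weighted_cross_term_le:
  fixes a b h H X Y x c k \<epsilon> :: real
  assumes XY: "X \<ge> 0" "Y \<ge> 0" "X \<le> exp (\<epsilon> * \<bar>x\<bar>) * Y" "Y \<le> exp (\<epsilon> * \<bar>x\<bar>) * X"
    and "\<epsilon> \<ge> 0" "h > 0" "H > 0" "2 * \<epsilon> * H \<le> h"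
    and c: "c \<ge> 0" "2 * c * exp (\<epsilon> * \<bar>x\<bar>) * (1 + \<bar>x\<bar>) \<le> k"
  shows "2 * c * a * b * (Y\<^sup>2 * (2 * H + h) - X\<^sup>2 * (2 * H - h)) \<le> k * h * (X\<^sup>2 * a\<^sup>2 + Y\<^sup>2 * b\<^sup>2)"
proof -
  define E where "E = exp (\<epsilon> * \<bar>x\<bar>)"
  have E: "E \<ge> 1" using assms by (simp add: E_def)
  have E1: "E - 1 \<le> \<epsilon> * \<bar>x\<bar> * E"
    using exp_ge_add_one_self[of "- (\<epsilon> * \<bar>x\<bar>)"] E by (simp add: E_def exp_minus field_simps)
  have XYn: "X * Y \<ge> 0" using assms by simp
  have sq: "X\<^sup>2 + Y\<^sup>2 \<le> 2 * E * (X * Y)" "\<bar>Y\<^sup>2 - X\<^sup>2\<bar> \<le> 2 * (E - 1) * (X * Y)"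
    using sum_diff_squares_le[of X Y E] XY E by (auto simp: E_def)
  have "\<bar>Y\<^sup>2 * (2 * H + h) - X\<^sup>2 * (2 * H - h)\<bar> = \<bar>(X\<^sup>2 + Y\<^sup>2) * h + (Y\<^sup>2 - X\<^sup>2) * (2 * H)\<bar>"
    by (simp add: algebra_simps)
  also have "\<dots> \<le> (X\<^sup>2 + Y\<^sup>2) * h + \<bar>Y\<^sup>2 - X\<^sup>2\<bar> * (2 * H)"
    using abs_triangle_ineq[of "(X\<^sup>2 + Y\<^sup>2) * h" "(Y\<^sup>2 - X\<^sup>2) * (2 * H)"] assms
    by (simp add: abs_mult)
  also have "\<dots> \<le> (2 * E * (X * Y)) * h + (2 * (E - 1) * (X * Y)) * (2 * H)"
    using sq assms by (intro add_mono mult_right_mono) auto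
  also have "\<dots> \<le> (2 * E * (X * Y)) * h + (2 * (\<epsilon> * \<bar>x\<bar> * E) * (X * Y)) * (2 * H)"
    using E E1 XYn assms(7) by (intro add_mono mult_right_mono mult_left_mono) auto
  also have "\<dots> = (2 * E * (X * Y)) * (h + \<bar>x\<bar> * (2 * \<epsilon> * H))"
    by (simp add: algebra_simps)
  also have "\<dots> \<le> (2 * E * (X * Y)) * (h + \<bar>x\<bar> * h)"
    using XYn E assms by (intro mult_left_mono add_mono) auto
  finally have W: "\<bar>Y\<^sup>2 * (2 * H + h) - X\<^sup>2 * (2 * H - h)\<bar> \<le> 2 * E * (1 + \<bar>x\<bar>) * h * (X * Y)"
    by (simp add: algebra_simps)
  have AM: "2 * (X * Y) * \<bar>a * b\<bar> \<le> X\<^sup>2 * a\<^sup>2 + Y\<^sup>2 * b\<^sup>2"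
    using sum_squares_bound[of "X * \<bar>a\<bar>" "Y * \<bar>b\<bar>"]
    by (simp add: power_mult_distrib abs_mult algebra_simps)
  have "2 * c * a * b * (Y\<^sup>2 * (2 * H + h) - X\<^sup>2 * (2 * H - h))
      \<le> \<bar>2 * c * a * b * (Y\<^sup>2 * (2 * H + h) - X\<^sup>2 * (2 * H - h))\<bar>"
    by simp
  also have "\<dots> = 2 * c * \<bar>a * b\<bar> * \<bar>Y\<^sup>2 * (2 * H + h) - X\<^sup>2 * (2 * H - h)\<bar>"
    using c by (simp add: abs_mult)
  also have "\<dots> \<le> 2 * c * \<bar>a * b\<bar> * (2 * E * (1 + \<bar>x\<bar>) * h * (X * Y))"
    using c W by (intro mult_left_mono) auto
  also have "\<dots> = (2 * c * E * (1 + \<bar>x\<bar>)) * h * (2 * (X * Y) * \<bar>a * b\<bar>)"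
    by (simp add: algebra_simps)
  also have "\<dots> \<le> k * h * (X\<^sup>2 * a\<^sup>2 + Y\<^sup>2 * b\<^sup>2)"
  proof -
    have "0 \<le> 2 * c * E * (1 + \<bar>x\<bar>)" using c E by simp
    then have "0 \<le> k" using c(2) unfolding E_def by linarith
    then show ?thesis
      using AM c XYn E assms(6) by (intro mult_mono) (auto simp: E_def)
  qed
  finally show ?thesis .
qed

section \<open>Integrated energy balance and the weighted Goursat estimate\<close>

lemma continuous_on_slice:
  assumes "continuous_on (A \<times> B) (\<lambda>(u, v). f u v)" "u \<in> A"
  shows "continuous_on B (f u)"
proof -
  have "continuous_on B (\<lambda>v. (u, v))" by (intro continuous_intros)
  then have "continuous_on B (\<lambda>v. (\<lambda>(u, v). f u v) (u, v))"
    by (rule continuous_on_compose2[OF assms(1)]) (use assms(2) in auto)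
  then show ?thesis by simp
qed

text \<open>Since \<open>W'\<close> dominates \<open>G'\<close>, the \<open>u\<close>-derivative of
  the integral of \<open>W u\<close> is at least \<open>G u V - G u 1\<close>, hence at least
  \<open>- K * exp (\<kappa> * u)\<close>. Adding \<open>K / \<kappa> * exp (\<kappa> * u)\<close>
  compensates for this loss, so the sum is nondecreasing in \<open>u\<close>. The added term does
  not depend on \<open>V\<close>.\<close>

lemma flux_balance_integral_le:
  fixes W W' G G' :: "real \<Rightarrow> real \<Rightarrow> real"
  assumes dW: "\<And>u v. u \<le> -1 \<Longrightarrow> v \<ge> 1 \<Longrightarrow> ((\<lambda>u. W u v) has_real_derivative W' u v) (at u within {..-1})"
    and dG: "\<And>u v. u \<le> -1 \<Longrightarrow> v \<ge> 1 \<Longrightarrow> ((\<lambda>v. G u v) has_real_derivative G' u v) (at v within {1..})"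
    and W'_cont: "continuous_on ({..-1} \<times> {1..}) (\<lambda>(u, v). W' u v)"
    and W_cont: "\<And>u. u \<le> -1 \<Longrightarrow> continuous_on {1..} (W u)"
    and le: "\<And>u v. u \<le> -1 \<Longrightarrow> v \<ge> 1 \<Longrightarrow> G' u v \<le> W' u v"
    and G_nonneg: "\<And>u v. u \<le> -1 \<Longrightarrow> v \<ge> 1 \<Longrightarrow> 0 \<le> G u v"
    and G_edge: "\<And>u. u \<le> -1 \<Longrightarrow> G u 1 \<le> K * exp (\<kappa> * u)"
    and "\<kappa> > 0" and u: "u \<le> u0" "u0 \<le> -1" and V: "V \<ge> 1"
  shows "integral {1..V} (W u) \<le> integral {1..V} (W u0) + K / \<kappa> * exp (\<kappa> * u0)"
proof -
  have W_int: "W u integrable_on {1..V}" if "u \<le> -1" for u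
    by (rule integrable_continuous_interval, rule continuous_on_subset[OF W_cont[OF that]]) auto
  have W'_cont_v: "continuous_on {1..} (W' u)" if "u \<le> -1" for u
    using continuous_on_slice[OF W'_cont] that by simp
  have W'_int: "W' u integrable_on {1..V}" if "u \<le> -1" for u
    by (rule integrable_continuous_interval, rule continuous_on_subset[OF W'_cont_v[OF that]]) auto
  have dE: "((\<lambda>u. integral {1..V} (W u)) has_real_derivative integral {1..V} (W' u)) (at u within {..-1})"
    if "u \<le> -1" for u
    unfolding interval_cbox
    by (rule leibniz_rule_field_derivative)
       (use that dW W_int continuous_on_subset[OF W'_cont, of "{..-1} \<times> {1..V}"]
         in \<open>auto simp: Times_subset_cancel2 subset_iff\<close>)
  have E'_ge: "integral {1..V} (W' u) \<ge> - (K * exp (\<kappa> * u))" if "u \<le> -1" for u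
  proof -
    have FTC: "(G' u has_integral G u V - G u 1) {1..V}"
    proof (rule fundamental_theorem_of_calculus[where f = "G u" and f' = "G' u", OF V])
      fix v assume "v \<in> {1..V}"
      then have "((\<lambda>v. G u v) has_real_derivative G' u v) (at v within {1..V})"
        by (intro has_field_derivative_subset[OF dG]) (use that in auto)
      then show "(G u has_vector_derivative G' u v) (at v within {1..V})"
        by (simp add: has_real_derivative_iff_has_vector_derivative)
    qed
    have "G u V - G u 1 \<le> integral {1..V} (W' u)"
      by (rule has_integral_le[OF FTC integrable_integral[OF W'_int]]) (use that le in auto)
    then show ?thesis using G_nonneg[of u V] G_edge[of u] that V by linarith
  qed
  define E where "E = (\<lambda>u. integral {1..V} (W u) + K / \<kappa> * exp (\<kappa> * u))"
  have dE2: "(E has_real_derivative integral {1..V} (W' u) + K * exp (\<kappa> * u)) (at u within {..-1})"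
    if "u \<le> -1" for u
    unfolding E_def
    by (rule derivative_eq_intros dE[OF that] refl)+ (use \<open>\<kappa> > 0\<close> in auto)
  have "E u \<le> E u0"
  proof (rule DERIV_nonneg_imp_increasing_open[OF \<open>u \<le> u0\<close>])
    fix x assume x: "u < x" "x < u0"
    have "at x within {..-1} = at x"
      by (rule at_within_interior) (use x u in auto)
    then show "\<exists>y. (E has_real_derivative y) (at x) \<and> 0 \<le> y"
      using dE2[of x] E'_ge[of x] x u by (intro exI conjI) (auto simp: add.commute)
  next
    show "continuous_on {u..u0} E"
      by (rule continuous_on_subset[OF DERIV_continuous_on[OF dE2]]) (use u in auto)
  qed
  moreover have "K / \<kappa> * exp (\<kappa> * u) \<ge> 0"
  proof -
    \<comment> \<open>The sign of \<open>K\<close> is read off at the corner \<open>u = -1\<close>,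
      \<open>v = 1\<close>, where \<open>G\<close> is nonnegative and below the edge bound.\<close>
    have "0 \<le> K * exp (\<kappa> * (-1))" using G_nonneg[of "-1" 1] G_edge[of "-1"] by simp
    then have "K \<ge> 0" by (simp add: zero_le_mult_iff)
    then show ?thesis using \<open>\<kappa> > 0\<close> by simp
  qed
  ultimately show ?thesis by (simp add: E_def)
qed

text \<open>For the fluxes \<open>W\<close> and \<open>G\<close> below, \<open>W' - G'\<close> is
  \<open>k * h * (p * a\<^sup>2 + q * b\<^sup>2)\<close> minus the cross term of
  \<open>weighted_cross_term_le\<close>, hence nonnegative, and
  \<open>flux_balance_integral_le\<close> applies. The extra factors lie between \<open>H\<close>
  and \<open>3 * H\<close>, so they cost only constants.\<close>

proposition goursat_weighted_energy:
  fixes a b :: "real \<Rightarrow> real \<Rightarrow> real" and c :: "real \<Rightarrow> real"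
  assumes "\<kappa> > 0"
    and c_nonneg: "\<And>x. 0 \<le> c x" and c_decay: "\<And>x. c x \<le> A * exp (- \<kappa> * \<bar>x\<bar>)"
    and c_cont: "continuous_on UNIV c"
    and da: "\<And>u v. u \<le> -1 \<Longrightarrow> v \<ge> 1 \<Longrightarrow>
      ((\<lambda>u. a u v) has_real_derivative c (u + v) * b u v) (at u within {..-1})"
    and db: "\<And>u v. u \<le> -1 \<Longrightarrow> v \<ge> 1 \<Longrightarrow>
      ((\<lambda>v. b u v) has_real_derivative c (u + v) * a u v) (at v within {1..})"
    and a_cont: "continuous_on ({..-1} \<times> {1..}) (\<lambda>(u, v). a u v)"
    and b_cont: "continuous_on ({..-1} \<times> {1..}) (\<lambda>(u, v). b u v)"
    and b_edge: "\<And>u. u \<le> -1 \<Longrightarrow> \<bar>b u 1\<bar> \<le> K * exp (\<kappa> * u)"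
    and u0: "u0 \<le> -1"
    and init: "\<And>V. V \<ge> 1 \<Longrightarrow> integral {1..V} (\<lambda>v. v ^ n * (a u0 v)\<^sup>2) \<le> K0"
  obtains C where "\<And>u V. u \<le> u0 \<Longrightarrow> V \<ge> 1 \<Longrightarrow> integral {1..V} (\<lambda>v. v ^ n * (a u v)\<^sup>2) \<le> C"
proof -
  have A: "A \<ge> 0" using c_nonneg[of 0] c_decay[of 0] by simp
  obtain L where L: "L > 0" "\<And>x. x \<ge> 0 \<Longrightarrow> (1 + x) ^ 3 * exp (- (\<kappa> / 2) * x) \<le> L"
    using power_exp_bounded[of "\<kappa> / 2" 3] \<open>\<kappa> > 0\<close> by auto
  \<comment> \<open>The factors are \<open>2 * H - h x\<close> for \<open>a\<^sup>2\<close> and \<open>2 * H + h x\<close> for \<open>b\<^sup>2\<close>: \<open>B\<close> makes \<open>- h'\<close> dominate the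
    coupling \<open>c\<close>, and small \<open>\<epsilon>\<close>, that is large \<open>T\<close>, controls the mismatch of the two polynomial weights.\<close>
  define B where "B = 2 * A * L"
  define H where "H = exp (B * (pi / 2))"
  define \<epsilon> where "\<epsilon> = min (\<kappa> / 2) (exp (- (B * (pi / 2))) / (2 * H))"
  define T where "T = 1 + n / \<epsilon>"
  define h where "h = (\<lambda>x. exp (- (B * arctan x)))"
  define k where "k = (\<lambda>x::real. B / (1 + x\<^sup>2))"
  have B: "B \<ge> 0" using A L by (simp add: B_def)
  have H: "H > 0" "\<epsilon> > 0" using \<open>\<kappa> > 0\<close> by (auto simp: H_def \<epsilon>_def)
  have T: "T \<ge> 1" "n \<le> \<epsilon> * T" using H by (auto simp: T_def field_simps)
  \<comment> \<open>As \<open>arctan\<close> is bounded by \<open>pi / 2\<close>, \<open>h\<close>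
    stays between \<open>exp (- (B * (pi / 2)))\<close> and \<open>H\<close>. The second entry of
    the minimum in \<open>\<epsilon>\<close> is chosen for the lower bound.\<close>
  have h: "h x > 0" "2 * \<epsilon> * H \<le> h x" "h x \<le> H" for x
  proof -
    have "\<bar>arctan x\<bar> \<le> pi / 2" using arctan_bounded[of x] by auto
    then have 1: "\<bar>B * arctan x\<bar> \<le> B * (pi / 2)"
      using B mult_left_mono[of "\<bar>arctan x\<bar>" "pi / 2" B] by (simp add: abs_mult)
    have "\<epsilon> \<le> exp (- (B * (pi / 2))) / (2 * H)" by (simp add: \<epsilon>_def)
    then have "2 * \<epsilon> * H \<le> exp (- (B * (pi / 2)))" using H by (simp add: field_simps)
    also have "\<dots> \<le> h x" using 1 by (simp add: h_def abs_le_iff)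
    finally show "2 * \<epsilon> * H \<le> h x" .
    show "h x > 0" "h x \<le> H" using 1 by (auto simp: h_def H_def)
  qed
  have dh: "(h has_real_derivative - (k x * h x)) (at x)" for x
    unfolding h_def k_def
    by (rule derivative_eq_intros refl)+ (auto simp: field_simps)
  \<comment> \<open>Half of the decay rate of \<open>c\<close> pays for
    \<open>exp (\<epsilon> * \<bar>x\<bar>)\<close>, as
    \<open>\<epsilon> \<le> \<kappa> / 2\<close>. The other half pays for the cubic factor, which
    arises from \<open>1 + \<bar>x\<bar>\<close> and the denominator \<open>1 + x\<^sup>2\<close> of
    \<open>k\<close>.\<close>
  have ck: "2 * c x * exp (\<epsilon> * \<bar>x\<bar>) * (1 + \<bar>x\<bar>) \<le> k x" for x
  proof -
    have "\<epsilon> * \<bar>x\<bar> \<le> \<kappa> / 2 * \<bar>x\<bar>" by (intro mult_right_mono) (auto simp: \<epsilon>_def)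
    moreover have sq: "1 + x\<^sup>2 \<le> (1 + \<bar>x\<bar>)\<^sup>2" by (simp add: power2_sum)
    ultimately have "c x * exp (\<epsilon> * \<bar>x\<bar>) * ((1 + \<bar>x\<bar>) * (1 + x\<^sup>2))
        \<le> (A * exp (- \<kappa> * \<bar>x\<bar>)) * exp (\<kappa> / 2 * \<bar>x\<bar>) * ((1 + \<bar>x\<bar>) * (1 + \<bar>x\<bar>)\<^sup>2)"
      using c_decay c_nonneg A sq by (intro mult_mono) auto
    also have "\<dots> = A * ((1 + \<bar>x\<bar>) ^ 3 * exp (- (\<kappa> / 2) * \<bar>x\<bar>))"
      by (simp add: exp_add[symmetric] power3_eq_cube power2_eq_square algebra_simps)
    also have "\<dots> \<le> A * L" using A L by (intro mult_left_mono) auto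
    finally have "2 * (c x * exp (\<epsilon> * \<bar>x\<bar>) * ((1 + \<bar>x\<bar>) * (1 + x\<^sup>2))) \<le> B"
      by (simp add: B_def)
    moreover have "1 + x\<^sup>2 > 0" by (simp add: add_pos_nonneg)
    ultimately show ?thesis by (simp add: k_def pos_le_divide_eq algebra_simps)
  qed
  \<comment> \<open>\<open>W\<close> is the flux density on lines of constant \<open>u\<close> and
    \<open>G\<close> the one on lines of constant \<open>v\<close>; \<open>W'\<close> is the
    \<open>u\<close>-derivative of \<open>W\<close>, and \<open>G'\<close> is the
    \<open>v\<close>-derivative of \<open>G\<close>. The term with \<open>k * h\<close> enters with
    opposite signs, so both contribute positively to \<open>W' - G'\<close>.\<close>
  define p q where "p = (\<lambda>v. (T + v) ^ n)" and "q = (\<lambda>u. (T - u) ^ n)"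
  define W where "W = (\<lambda>u v. p v * (2 * H - h (u + v)) * (a u v)\<^sup>2)"
  define W' where "W' = (\<lambda>u v. p v * (k (u + v) * h (u + v)) * (a u v)\<^sup>2
     + p v * (2 * H - h (u + v)) * (2 * a u v * (c (u + v) * b u v)))"
  define G where "G = (\<lambda>u v. q u * (2 * H + h (u + v)) * (b u v)\<^sup>2)"
  define G' where "G' = (\<lambda>u v. q u * (- (k (u + v) * h (u + v))) * (b u v)\<^sup>2
     + q u * (2 * H + h (u + v)) * (2 * b u v * (c (u + v) * a u v)))"
  obtain L2 where L2: "L2 > 0" "\<And>x. x \<ge> 0 \<Longrightarrow> (1 + x) ^ n * exp (- \<kappa> * x) \<le> L2"
    using power_exp_bounded[of "\<kappa>" n] \<open>\<kappa> > 0\<close> by auto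
  have dh_u: "((\<lambda>u. h (u + v)) has_real_derivative - (k (u + v) * h (u + v))) (at u within S)" for u v S
  proof -
    have "((\<lambda>u. u + v) has_real_derivative 1) (at u within S)" by (auto intro!: derivative_eq_intros)
    from DERIV_chain2[OF dh this] show ?thesis by simp
  qed
  have dh_v: "((\<lambda>v. h (u + v)) has_real_derivative - (k (u + v) * h (u + v))) (at v within S)" for u v S
  proof -
    have "((\<lambda>v. u + v) has_real_derivative 1) (at v within S)" by (auto intro!: derivative_eq_intros)
    from DERIV_chain2[OF dh this] show ?thesis by simp
  qed
  have h_cont: "continuous_on UNIV h" and k_cont: "continuous_on UNIV k"
    unfolding h_def k_def
    by (auto intro!: continuous_intros simp: add_nonneg_eq_0_iff)
  have h_cont2: "continuous_on S (\<lambda>x. h (F x))" and k_cont2: "continuous_on S (\<lambda>x. k (F x))"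
    and c_cont2: "continuous_on S (\<lambda>x. c (F x))"
    if "continuous_on S F" for S :: "'z::topological_space set" and F
    using continuous_on_compose2[OF h_cont that] continuous_on_compose2[OF k_cont that]
      continuous_on_compose2[OF c_cont that] by auto
  have a_cont_v: "continuous_on {1..} (a u)" if "u \<le> -1" for u
    using continuous_on_slice[OF a_cont] that by simp
  have main: "integral {1..V} (W u) \<le> integral {1..V} (W u0) + (T ^ n * L2 * (3 * H) * K\<^sup>2) / \<kappa> * exp (\<kappa> * u0)"
    if "u \<le> u0" "V \<ge> 1" for u V
  proof (rule flux_balance_integral_le[where G = G and G' = G' and W' = W'])
    fix u v :: real assume uv: "u \<le> -1" "v \<ge> 1"
    show "((\<lambda>u. W u v) has_real_derivative W' u v) (at u within {..-1})"
      unfolding W_def W'_def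
      by (rule derivative_eq_intros dh_u da[OF uv] refl)+ (simp add: algebra_simps)
    show "((\<lambda>v. G u v) has_real_derivative G' u v) (at v within {1..})"
      unfolding G_def G'_def
      by (rule derivative_eq_intros dh_v db[OF uv] refl)+ (simp add: algebra_simps)
    show "0 \<le> G u v"
      using uv T H h[of "u + v"] by (auto simp: G_def q_def intro!: mult_nonneg_nonneg)
    have pq: "p v \<ge> 0" "q u \<ge> 0" using T uv by (auto simp: p_def q_def)
    have ratio: "p v \<le> exp (\<epsilon> * \<bar>u + v\<bar>) * q u" "q u \<le> exp (\<epsilon> * \<bar>u + v\<bar>) * p v"
      using shifted_power_ratio[of v "- u" T n \<epsilon>] shifted_power_ratio[of "- u" v T n \<epsilon>] T uv
      by (auto simp: p_def q_def add.commute abs_minus_commute)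
    \<comment> \<open>The cross term estimate takes the weights as squares, so the ratio bounds are
      passed to square roots. The exponential is kept unhalved, which is allowed because it is at
      least 1.\<close>
    have sqrt_le: "sqrt y \<le> exp (\<epsilon> * \<bar>u + v\<bar>) * sqrt z"
      if "y \<le> exp (\<epsilon> * \<bar>u + v\<bar>) * z" "z \<ge> 0" for y z
    proof (rule real_le_lsqrt)
      have "1 * exp (\<epsilon> * \<bar>u + v\<bar>) \<le> exp (\<epsilon> * \<bar>u + v\<bar>) * exp (\<epsilon> * \<bar>u + v\<bar>)"
        using H by (intro mult_right_mono) auto
      then have "exp (\<epsilon> * \<bar>u + v\<bar>) * z \<le> (exp (\<epsilon> * \<bar>u + v\<bar>))\<^sup>2 * z"
        using that by (intro mult_right_mono) (auto simp: power2_eq_square)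
      then show "y \<le> (exp (\<epsilon> * \<bar>u + v\<bar>) * sqrt z)\<^sup>2"
        using that by (simp add: power_mult_distrib)
    qed (use that in auto)
    have "2 * c (u + v) * a u v * b u v * ((sqrt (q u))\<^sup>2 * (2 * H + h (u + v)) - (sqrt (p v))\<^sup>2 * (2 * H - h (u + v)))
       \<le> k (u + v) * h (u + v) * ((sqrt (p v))\<^sup>2 * (a u v)\<^sup>2 + (sqrt (q u))\<^sup>2 * (b u v)\<^sup>2)"
      by (rule weighted_cross_term_le[where \<epsilon> = \<epsilon> and x = "u + v"]) (use pq ratio sqrt_le h H c_nonneg ck in auto)
    then show "G' u v \<le> W' u v"
      using pq by (simp add: G'_def W'_def algebra_simps)
  next
    show "continuous_on ({..-1} \<times> {1..}) (\<lambda>(u, v). W' u v)"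
      using a_cont b_cont unfolding W'_def p_def case_prod_beta
      by (intro continuous_intros h_cont2 k_cont2 c_cont2)
    show "continuous_on {1..} (W u)" if "u \<le> -1" for u
      unfolding W_def p_def by (intro continuous_intros h_cont2 a_cont_v that)
  next
    fix u :: real assume u: "u \<le> -1"
    have "q u \<le> (T * (1 - u)) ^ n"
    proof -
      have "0 \<le> (T - 1) * (- u)" using T u by (intro mult_nonneg_nonneg) auto
      then show ?thesis using T u unfolding q_def
        by (intro power_mono) (auto simp: algebra_simps)
    qed
    then have q: "q u * exp (\<kappa> * u) \<le> T ^ n * L2"
    proof -
      have "q u * exp (\<kappa> * u) \<le> (T * (1 - u)) ^ n * exp (\<kappa> * u)"
        using \<open>q u \<le> _\<close> by (intro mult_right_mono) auto
      also have "\<dots> = T ^ n * ((1 + (- u)) ^ n * exp (- \<kappa> * (- u)))"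
        by (simp add: power_mult_distrib)
      also have "\<dots> \<le> T ^ n * L2" using L2(2)[of "- u"] T u by (intro mult_left_mono) auto
      finally show ?thesis .
    qed
    have qn: "0 \<le> q u" using T u by (auto simp: q_def)
    have "(b u 1)\<^sup>2 \<le> (K * exp (\<kappa> * u))\<^sup>2"
      using b_edge[OF u] by (metis abs_ge_zero power2_abs power_mono)
    then have "G u 1 \<le> q u * (3 * H) * (K * exp (\<kappa> * u))\<^sup>2"
      using qn h[of "u + 1"] H unfolding G_def by (intro mult_mono mult_left_mono) auto
    \<comment> \<open>Of the two factors \<open>exp (\<kappa> * u)\<close> in the square, one pays
      for the growth of \<open>q\<close> and the other remains as the decay required at the
      edge.\<close>
    also have "\<dots> = (q u * exp (\<kappa> * u)) * ((3 * H) * K\<^sup>2 * exp (\<kappa> * u))"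
      by (simp add: power2_eq_square algebra_simps)
    also have "\<dots> \<le> (T ^ n * L2) * ((3 * H) * K\<^sup>2 * exp (\<kappa> * u))"
      using q H by (intro mult_right_mono) auto
    finally show "G u 1 \<le> (T ^ n * L2 * (3 * H) * K\<^sup>2) * exp (\<kappa> * u)"
      by (simp add: algebra_simps)
  qed (use \<open>\<kappa> > 0\<close> u0 that in auto)
  \<comment> \<open>Here and in \<open>int_ge\<close> the shifted weight is compared with
    \<open>v ^ n\<close>: for \<open>v \<ge> 1\<close> one has
    \<open>v \<le> T + v \<le> (T + 1) * v\<close>, and \<open>2 * H - h\<close> lies between
    \<open>H\<close> and \<open>2 * H\<close>.\<close>
  have int_le: "integral {1..V} (W u0) \<le> (T + 1) ^ n * (2 * H) * K0" if "V \<ge> 1" for V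
  proof -
    have "integral {1..V} (W u0) \<le> integral {1..V} (\<lambda>v. (T + 1) ^ n * (2 * H) * (v ^ n * (a u0 v)\<^sup>2))"
    proof (rule integral_le)
      show "W u0 integrable_on {1..V}"
        unfolding W_def p_def
        by (intro integrable_continuous_interval continuous_intros h_cont2 continuous_on_subset[OF a_cont_v] u0) auto
      show "(\<lambda>v. (T + 1) ^ n * (2 * H) * (v ^ n * (a u0 v)\<^sup>2)) integrable_on {1..V}"
        by (intro integrable_continuous_interval continuous_intros continuous_on_subset[OF a_cont_v] u0) auto
      fix v assume "v \<in> {1..V}"
      then have v: "v \<ge> 1" by simp
      have "p v \<le> ((T + 1) * v) ^ n"
        unfolding p_def using T v mult_left_mono[of 1 v T] by (intro power_mono) (auto simp: algebra_simps)
      then have "W u0 v \<le> ((T + 1) * v) ^ n * (2 * H) * (a u0 v)\<^sup>2"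
        unfolding W_def using h[of "u0 + v"] H T v
        by (intro mult_right_mono mult_mono) (auto simp: p_def)
      then show "W u0 v \<le> (T + 1) ^ n * (2 * H) * (v ^ n * (a u0 v)\<^sup>2)"
        unfolding power_mult_distrib by (simp only: mult_ac)
    qed
    also have "\<dots> = (T + 1) ^ n * (2 * H) * integral {1..V} (\<lambda>v. v ^ n * (a u0 v)\<^sup>2)"
      by (rule integral_mult_right)
    also have "\<dots> \<le> (T + 1) ^ n * (2 * H) * K0"
      using init[OF that] H T by (intro mult_left_mono) auto
    finally show ?thesis .
  qed
  have int_ge: "H * integral {1..V} (\<lambda>v. v ^ n * (a u v)\<^sup>2) \<le> integral {1..V} (W u)" if "u \<le> -1" for u V
  proof -
    have "integral {1..V} (\<lambda>v. H * (v ^ n * (a u v)\<^sup>2)) \<le> integral {1..V} (W u)"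
    proof (rule integral_le)
      show "W u integrable_on {1..V}"
        unfolding W_def p_def
        by (intro integrable_continuous_interval continuous_intros h_cont2 continuous_on_subset[OF a_cont_v] that) auto
      show "(\<lambda>v. H * (v ^ n * (a u v)\<^sup>2)) integrable_on {1..V}"
        by (intro integrable_continuous_interval continuous_intros continuous_on_subset[OF a_cont_v] that) auto
      fix v assume "v \<in> {1..V}"
      then have v: "v \<ge> 1" by simp
      have "v ^ n * H * (a u v)\<^sup>2 \<le> W u v"
        unfolding W_def p_def using h[of "u + v"] H T v
        by (intro mult_right_mono mult_mono power_mono) auto
      then show "H * (v ^ n * (a u v)\<^sup>2) \<le> W u v" by (simp add: algebra_simps)
    qed
    then show ?thesis by simp
  qed
  show thesis
  proof (rule that)
    fix u V :: real assume uV: "u \<le> u0" "V \<ge> 1"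
    have "H * integral {1..V} (\<lambda>v. v ^ n * (a u v)\<^sup>2)
       \<le> (T + 1) ^ n * (2 * H) * K0 + (T ^ n * L2 * (3 * H) * K\<^sup>2) / \<kappa> * exp (\<kappa> * u0)"
      using int_ge[of u V] main[OF uV] int_le[of V] uV u0 by linarith
    then show "integral {1..V} (\<lambda>v. v ^ n * (a u v)\<^sup>2)
       \<le> ((T + 1) ^ n * (2 * H) * K0 + (T ^ n * L2 * (3 * H) * K\<^sup>2) / \<kappa> * exp (\<kappa> * u0)) / H"
      using H by (simp add: pos_le_divide_eq mult.commute)
  qed
qed

section \<open>Integrals and mixed derivatives\<close>

text \<open>\<open>wave_eq\<close> supplies only the \<open>u\<close>-derivative of the
  \<open>v\<close>-derivative; the equation for \<open>b\<close> needs the other order. Writing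
  \<open>f u w - f u 1\<close> as the integral of \<open>fv u\<close> and differentiating under the
  integral expresses \<open>fu u w - fu u 1\<close> as the integral of \<open>fuv u\<close>, which
  can be differentiated in \<open>w\<close>.\<close>

lemma mixed_derivative_swap:
  fixes f fu fv fuv :: "real \<Rightarrow> real \<Rightarrow> real"
  assumes fu: "\<And>u v. u \<in> I \<Longrightarrow> v \<ge> 1 \<Longrightarrow> ((\<lambda>u. f u v) has_real_derivative fu u v) (at u within I)"
    and fv: "\<And>u v. u \<in> I \<Longrightarrow> v \<ge> 1 \<Longrightarrow> (f u has_real_derivative fv u v) (at v within {1..})"
    and fuv: "\<And>u v. u \<in> I \<Longrightarrow> v \<ge> 1 \<Longrightarrow> ((\<lambda>u. fv u v) has_real_derivative fuv u v) (at u within I)"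
    and fv_cont: "\<And>u. u \<in> I \<Longrightarrow> continuous_on {1..} (fv u)"
    and fuv_cont: "continuous_on (I \<times> {1..}) (\<lambda>(u, v). fuv u v)"
    and "convex I" and u: "u \<in> I" "at u within I \<noteq> bot" and v: "v \<ge> 1"
  shows "(fu u has_real_derivative fuv u v) (at v within {1..})"
proof -
  have fuv_cont_v: "continuous_on {1..} (fuv u)"
    using continuous_on_slice[OF fuv_cont u(1)] .
  have eq: "fu u w = fu u 1 + integral {1..w} (fuv u)" if "w \<ge> 1" for w
  proof -
    have FTC: "integral {1..w} (fv u') = f u' w - f u' 1" if "u' \<in> I" for u'
    proof (rule integral_unique, rule fundamental_theorem_of_calculus[OF \<open>w \<ge> 1\<close>])
      fix x assume "x \<in> {1..w}"
      then have "(f u' has_real_derivative fv u' x) (at x within {1..w})"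
        by (intro has_field_derivative_subset[OF fv]) (use that in auto)
      then show "(f u' has_vector_derivative fv u' x) (at x within {1..w})"
        by (simp add: has_real_derivative_iff_has_vector_derivative)
    qed
    have "((\<lambda>u. integral {1..w} (fv u)) has_real_derivative integral {1..w} (fuv u)) (at u within I)"
      unfolding interval_cbox
    proof (rule leibniz_rule_field_derivative)
      show "fv u' integrable_on cbox 1 w" if "u' \<in> I" for u'
        using integrable_continuous_interval[OF continuous_on_subset[OF fv_cont[OF that]], of 1 w]
        by simp
      show "continuous_on (I \<times> cbox 1 w) (\<lambda>(x, t). fuv x t)"
        by (rule continuous_on_subset[OF fuv_cont]) auto
    qed (use fuv u \<open>convex I\<close> in auto)
    then have "((\<lambda>u. f u w - f u 1) has_real_derivative integral {1..w} (fuv u)) (at u within I)"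
      by (rule has_field_derivative_transform_within[of _ _ _ _ 1]) (use FTC u in auto)
    moreover have "((\<lambda>u. f u w - f u 1) has_real_derivative fu u w - fu u 1) (at u within I)"
      by (intro DERIV_diff fu u that) simp
    ultimately have "fu u w - fu u 1 = integral {1..w} (fuv u)"
      unfolding has_real_derivative_iff_has_vector_derivative
      by (rule vector_derivative_unique_within[OF u(2), symmetric])
    then show ?thesis by simp
  qed
  \<comment> \<open>The interval reaches past \<open>v\<close>, so that near \<open>v\<close> it
    coincides with the whole ray and the derivative within the ray follows.\<close>
  have "((\<lambda>w. integral {1..w} (fuv u)) has_real_derivative fuv u v) (at v within {1..v + 1})"
    by (rule integral_has_real_derivative) (use v in \<open>auto intro: continuous_on_subset[OF fuv_cont_v]\<close>)
  moreover have "at v within {1..v + 1} = at v within {1..}"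
    by (rule at_within_nhd[of _ "{..<v + 1}"]) auto
  ultimately have "((\<lambda>w. integral {1..w} (fuv u)) has_real_derivative fuv u v) (at v within {1..})"
    by simp
  from DERIV_add[OF DERIV_const this, of "fu u 1"]
  have "((\<lambda>w. fu u 1 + integral {1..w} (fuv u)) has_real_derivative fuv u v) (at v within {1..})"
    by simp
  then show ?thesis
  proof (rule has_field_derivative_transform_within[of _ _ _ _ 1])
    show "fu u 1 + integral {1..x} (fuv u) = fu u x" if "x \<in> {1..}" for x
      using eq[of x] that by simp
  qed (use v in auto)
qed

text \<open>Used with \<open>L\<close> equal to \<open>log (1/\<Omega>)\<close>, which is bounded
  below linearly only for large \<open>v\<close>. Before \<open>V1\<close> the integral of the
  continuous function is a fixed number; beyond \<open>V1\<close> the weight \<open>v ^ n\<close> is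
  at most \<open>L v ^ n / \<delta> ^ n\<close>.\<close>

lemma weighted_integral_bounded:
  fixes L y :: "real \<Rightarrow> real"
  assumes int: "set_integrable lborel {1..} (\<lambda>v. L v ^ n * (y v)\<^sup>2)"
    and y: "continuous_on {1..} y"
    and "\<delta> > 0" "V1 \<ge> 1" and L: "\<And>v. v \<ge> V1 \<Longrightarrow> \<delta> * v \<le> L v"
  obtains K where "\<And>V. V \<ge> 1 \<Longrightarrow> integral {1..V} (\<lambda>v. v ^ n * (y v)\<^sup>2) \<le> K"
proof (rule that)
  fix V :: real assume "V \<ge> 1"
  \<comment> \<open>Raising the endpoint to at least \<open>V1\<close> allows the split at
    \<open>V1\<close> and only enlarges the integral, the integrand being nonnegative.\<close>
  define W where "W = max V V1"
  let ?g = "\<lambda>v. v ^ n * (y v)\<^sup>2" and ?w = "\<lambda>v. L v ^ n * (y v)\<^sup>2"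
  have g_int: "?g integrable_on {a..b}" if "a \<ge> 1" for a b
    by (intro integrable_continuous_interval continuous_intros continuous_on_subset[OF y]) (use that in auto)
  have "set_integrable lborel S ?w" if "S \<subseteq> {V1..}" "S \<in> sets borel" for S
    by (rule set_integrable_subset[OF int]) (use that \<open>V1 \<ge> 1\<close> in auto)
  then have w_int: "?w integrable_on S" if "S \<subseteq> {V1..}" "S \<in> sets borel" for S
    using set_borel_integral_eq_integral(1) that by blast
  have w_nonneg: "0 \<le> ?w v" if "v \<ge> V1" for v
  proof -
    have "0 \<le> \<delta> * v" using that \<open>\<delta> > 0\<close> \<open>V1 \<ge> 1\<close> by simp
    then show ?thesis using L[OF that] by simp
  qed
  have "integral {1..V} ?g \<le> integral {1..W} ?g"
    by (rule integral_subset_le) (use g_int in \<open>auto simp: W_def\<close>)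
  also have "\<dots> = integral {1..V1} ?g + integral {V1..W} ?g"
    using Henstock_Kurzweil_Integration.integral_combine[OF _ _ g_int, of 1 V1 W] \<open>V1 \<ge> 1\<close> by (simp add: W_def)
  also have "integral {V1..W} ?g \<le> integral {V1..W} (\<lambda>v. ?w v / \<delta> ^ n)"
  proof (rule integral_le)
    show "(\<lambda>v. ?w v / \<delta> ^ n) integrable_on {V1..W}"
      by (rule integrable_on_divide[OF w_int]) auto
    fix v assume "v \<in> {V1..W}"
    then have v: "v \<ge> V1" by simp
    have "(\<delta> * v) ^ n \<le> L v ^ n"
      using v L[OF v] \<open>\<delta> > 0\<close> \<open>V1 \<ge> 1\<close> by (intro power_mono) auto
    then have "(\<delta> ^ n * v ^ n) * (y v)\<^sup>2 \<le> L v ^ n * (y v)\<^sup>2"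
      by (intro mult_right_mono) (auto simp: power_mult_distrib)
    then show "?g v \<le> ?w v / \<delta> ^ n"
      using \<open>\<delta> > 0\<close> by (simp add: pos_le_divide_eq mult_ac)
  qed (use g_int \<open>V1 \<ge> 1\<close> in auto)
  also have "\<dots> = integral {V1..W} ?w / \<delta> ^ n" by simp
  also have "\<dots> \<le> integral {V1..} ?w / \<delta> ^ n"
    by (intro divide_right_mono integral_subset_le w_int) (use w_nonneg \<open>\<delta> > 0\<close> in auto)
  finally show "integral {1..V} ?g \<le> integral {1..V1} ?g + integral {V1..} ?w / \<delta> ^ n"
    by simp
qed

text \<open>Fatou's lemma for the truncations of \<open>g k\<close> to
  \<open>{1..1 + real k}\<close>: each truncated integral is covered by \<open>bound\<close>, and
  the truncation disappears in the pointwise limit.\<close>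

lemma set_integrable_pointwise_limit:
  fixes g :: "nat \<Rightarrow> real \<Rightarrow> real" and h :: "real \<Rightarrow> real"
  assumes g: "\<And>k. continuous_on {1..} (g k)" and h: "continuous_on {1..} h"
    and nonneg: "\<And>k v. v \<ge> 1 \<Longrightarrow> 0 \<le> g k v"
    and lim: "\<And>v. v \<ge> 1 \<Longrightarrow> (\<lambda>k. g k v) \<longlonglongrightarrow> h v"
    and bound: "\<And>k V. V \<ge> 1 \<Longrightarrow> integral {1..V} (g k) \<le> C"
  shows "set_integrable lborel {1..} h"
proof -
  define G where "G = (\<lambda>k v. indicator {1..1 + real k} v *\<^sub>R g k v)"
  define H where "H = (\<lambda>v. indicator {1..} v *\<^sub>R h v)"
  have h_nonneg: "0 \<le> h v" if "v \<ge> 1" for v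
    using tendsto_lowerbound[OF lim[OF that]] nonneg[OF that] by auto
  have H_nonneg: "0 \<le> H v" for v using h_nonneg by (auto simp: H_def indicator_def)
  have H_meas: "H \<in> borel_measurable lborel"
    using borel_measurable_continuous_on_indicator[OF _ h] by (simp add: H_def)
  have G_meas: "G k \<in> borel_measurable borel" for k
    using borel_measurable_continuous_on_indicator[OF _ continuous_on_subset[OF g, of "{1..1 + real k}" k]]
    by (auto simp: G_def)
  have G_nonneg: "0 \<le> G k v" for k v using nonneg by (auto simp: G_def indicator_def)
  have G_lim: "(\<lambda>k. G k v) \<longlonglongrightarrow> H v" for v
  proof (cases "v \<ge> 1")
    case True
    have "\<forall>\<^sub>F k in sequentially. v - 1 \<le> real k"
      using eventually_ge_at_top[of "nat \<lceil>v - 1\<rceil>"] by eventually_elim linarith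
    then have "\<forall>\<^sub>F k in sequentially. g k v = G k v"
      by eventually_elim (use True in \<open>auto simp: G_def\<close>)
    then show ?thesis
      using Lim_transform_eventually[OF lim[OF True]] True by (simp add: H_def)
  next
    case False
    then show ?thesis by (simp add: G_def H_def)
  qed
  have G_int: "(\<integral>\<^sup>+ v. ennreal (G k v) \<partial>lborel) \<le> ennreal C" for k
  proof -
    have "(g k has_integral integral {1..1 + real k} (g k)) {1..1 + real k}"
      by (intro integrable_integral integrable_continuous_interval continuous_on_subset[OF g]) auto
    then have "((\<lambda>v. if v \<in> {1..1 + real k} then g k v else 0) has_integral integral {1..1 + real k} (g k)) UNIV"
      by (simp only: has_integral_restrict_UNIV)
    moreover have "(\<lambda>v. if v \<in> {1..1 + real k} then g k v else 0) = G k"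
      by (auto simp: G_def indicator_def)
    ultimately have "(G k has_integral integral {1..1 + real k} (g k)) UNIV" by simp
    from nn_integral_has_integral_lborel[OF G_meas G_nonneg this]
    show ?thesis using bound[of "1 + real k" k] by (simp add: ennreal_leI)
  qed
  have "(\<integral>\<^sup>+ v. ennreal (H v) \<partial>lborel) = (\<integral>\<^sup>+ v. liminf (\<lambda>k. ennreal (G k v)) \<partial>lborel)"
    by (intro nn_integral_cong lim_imp_Liminf[symmetric] tendsto_ennrealI G_lim) auto
  also have "\<dots> \<le> liminf (\<lambda>k. \<integral>\<^sup>+ v. ennreal (G k v) \<partial>lborel)"
    by (rule nn_integral_liminf) (use G_meas in auto)
  also have "\<dots> \<le> ennreal C"
    by (rule order_trans[OF Liminf_mono[OF always_eventually[OF allI[OF G_int]]]]) (simp add: Liminf_const)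
  finally have "(\<integral>\<^sup>+ v. ennreal (norm (H v)) \<partial>lborel) < \<infinity>"
    using H_nonneg by (simp add: le_less_trans[OF _ ennreal_less_top])
  then have "integrable lborel H"
    using H_meas by (intro integrableI_bounded) auto
  then show ?thesis by (simp add: set_integrable_def H_def)
qed

text \<open>Nontriviality of these filters makes the one-sided derivatives in \<open>pd_u\<close>
  and \<open>pd_v\<close> unique, also at the endpoint of the ray.\<close>

lemma at_within_ray_ne_bot:
  "v \<ge> a \<Longrightarrow> at v within {a..} \<noteq> bot" "v \<le> a \<Longrightarrow> at v within {..a} \<noteq> bot" for a v :: real
proof -
  have "at_right v \<le> at v within {a..}" if "v \<ge> a" by (rule at_le) (use that in auto)
  then show "v \<ge> a \<Longrightarrow> at v within {a..} \<noteq> bot"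
    using trivial_limit_at_right_real[of v] by (auto simp: bot_unique)
  have "at_left v \<le> at v within {..a}" if "v \<le> a" by (rule at_le) (use that in auto)
  then show "v \<le> a \<Longrightarrow> at v within {..a} \<noteq> bot"
    using trivial_limit_at_left_real[of v] by (auto simp: bot_unique)
qed

section \<open>The tortoise coordinate\<close>

lemma has_real_derivative_ln_abs:
  fixes x c :: real
  assumes "x \<noteq> c"
  shows "((\<lambda>x. ln \<bar>x - c\<bar>) has_real_derivative 1 / (x - c)) (at x)"
proof (cases "x > c")
  case True
  have "((\<lambda>x. ln (x - c)) has_real_derivative 1 / (x - c)) (at x)"
    using True by (auto intro!: derivative_eq_intros)
  then show ?thesis
    by (rule has_field_derivative_transform_within_open[of _ _ _ "{c<..}"]) (use True in auto)
next
  case False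
  have "((\<lambda>x. ln (c - x)) has_real_derivative 1 / (x - c)) (at x)"
    using False assms by (auto intro!: derivative_eq_intros simp: field_simps)
  then show ?thesis
    by (rule has_field_derivative_transform_within_open[of _ _ _ "{..<c}"]) (use False assms in auto)
qed

text \<open>Inverse function theorem in the form of an autonomous equation: the inverse
  \<open>y\<close> satisfies \<open>y' = G y\<close>. For the tortoise coordinate \<open>G\<close>
  is \<open>rn_F M e\<close>.\<close>

lemma the_inv_into_has_real_derivative:
  fixes f G :: "real \<Rightarrow> real"
  assumes "open S" "inj_on f S" "f ` S = UNIV"
    and df: "\<And>r. r \<in> S \<Longrightarrow> (f has_real_derivative 1 / G r) (at r)"
    and "\<And>r. r \<in> S \<Longrightarrow> G r \<noteq> 0"
  shows "(the_inv_into S f has_real_derivative G (the_inv_into S f x)) (at x)"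
proof -
  have r: "the_inv_into S f x \<in> S" "f (the_inv_into S f x) = x"
    using assms the_inv_into_into[of f S x S] f_the_inv_into_f[of f S x] by auto
  define y where "y = the_inv_into S f x"
  have y: "y \<in> S" "f y = x" "G y \<noteq> 0" using r assms(5) by (auto simp: y_def)
  have "(the_inv_into S f has_derivative (*) (G y)) (at (f y))"
  proof (rule has_derivative_inverse_strong[OF \<open>open S\<close> y(1)])
    show "continuous_on S f" by (rule DERIV_continuous_on, rule has_field_derivative_at_within, rule df)
    show "(f has_derivative (*) (1 / G y)) (at y)"
      using df[OF y(1)] by (simp add: has_field_derivative_def)
    show "(*) (1 / G y) \<circ> (*) (G y) = id" using y by auto
  qed (simp add: the_inv_into_f_f assms(2))
  then show ?thesis using y by (simp add: has_field_derivative_def y_def)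
qed

lemma continuous_image_eq_UNIV:
  fixes f :: "real \<Rightarrow> real"
  assumes "connected S" "continuous_on S f"
    and "\<And>y. \<exists>r\<in>S. f r \<le> y" "\<And>y. \<exists>r\<in>S. y \<le> f r"
  shows "f ` S = UNIV"
proof -
  have "y \<in> f ` S" for y
  proof -
    obtain r1 r2 where "r1 \<in> S" "f r1 \<le> y" "r2 \<in> S" "y \<le> f r2" using assms(3,4) by meson
    then show ?thesis
      using connected_contains_Icc[OF connected_continuous_image[OF assms(2,1)], of "f r1" "f r2"]
      by (auto simp: subset_iff)
  qed
  then show ?thesis by auto
qed

locale subextremal =
  fixes M e :: real
  assumes charged: "0 < \<bar>e\<bar>" and below_extremal: "\<bar>e\<bar> < M"
begin

abbreviation "rp \<equiv> r_plus M e"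
abbreviation "rm \<equiv> r_minus M e"
text \<open>The area radius depends on \<open>u\<close> and \<open>v\<close> only through the
  tortoise coordinate; \<open>R_int\<close> and \<open>R_ext\<close> express it in that single
  variable.\<close>

abbreviation "R_int \<equiv> the_inv_into {rm<..<rp} (r_star M e)"
abbreviation "R_ext \<equiv> the_inv_into {rp<..} (r_star M e)"
abbreviation "F \<equiv> rn_F M e"

lemma e_sq: "0 < e\<^sup>2" "e\<^sup>2 < M\<^sup>2"
  using charged below_extremal power_strict_mono[of "\<bar>e\<bar>" M 2] by auto

lemma horizons: "0 < rm" "rm < rp" "0 < rp"
proof -
  have "sqrt (M\<^sup>2 - e\<^sup>2) < M" "0 < sqrt (M\<^sup>2 - e\<^sup>2)"
    using e_sq charged below_extremal by (auto intro: real_less_lsqrt)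
  then show "0 < rm" "rm < rp" "0 < rp"
    unfolding r_minus_def r_plus_def by linarith+
qed

lemma F_factored: "r \<noteq> 0 \<Longrightarrow> F r = (r - rp) * (r - rm) / r\<^sup>2"
proof -
  have "(sqrt (M\<^sup>2 - e\<^sup>2))\<^sup>2 = M\<^sup>2 - e\<^sup>2" using e_sq by simp
  then show "r \<noteq> 0 \<Longrightarrow> F r = (r - rp) * (r - rm) / r\<^sup>2"
    unfolding rn_F_def r_plus_def r_minus_def
    by (simp add: field_simps power2_eq_square)
qed

text \<open>The logarithmic coefficients are the residues of \<open>1 / F\<close> at the two
  horizons. In this form their signs are visible: positive at \<open>rp\<close>, negative at
  \<open>rm\<close>.\<close>

lemma r_star_eq:
  "r_star M e r = r + rp\<^sup>2 / (rp - rm) * ln \<bar>r - rp\<bar> - rm\<^sup>2 / (rp - rm) * ln \<bar>r - rm\<bar>"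
proof -
  define s where "s = sqrt (M\<^sup>2 - e\<^sup>2)"
  have s: "s > 0" "s\<^sup>2 = M\<^sup>2 - e\<^sup>2" using e_sq by (auto simp: s_def)
  have "(M + s)\<^sup>2 = 2 * s * M + (2 * M\<^sup>2 - e\<^sup>2)" "(M - s)\<^sup>2 = (2 * M\<^sup>2 - e\<^sup>2) - 2 * s * M"
    using s by (simp_all add: power2_sum power2_diff)
  then have "M + (2 * M\<^sup>2 - e\<^sup>2) / (2 * s) = rp\<^sup>2 / (rp - rm)"
    "M - (2 * M\<^sup>2 - e\<^sup>2) / (2 * s) = - (rm\<^sup>2 / (rp - rm))"
    using s unfolding r_plus_def r_minus_def s_def[symmetric]
    by (auto simp: add_divide_distrib diff_divide_distrib)
  then show ?thesis unfolding r_star_def s_def[symmetric] by simp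
qed

lemma r_star_has_derivative:
  assumes "r > 0" "r \<noteq> rp" "r \<noteq> rm"
  shows "(r_star M e has_real_derivative 1 / F r) (at r)"
proof -
  have "(r_star M e has_real_derivative
      1 + rp\<^sup>2 / (rp - rm) * (1 / (r - rp)) - rm\<^sup>2 / (rp - rm) * (1 / (r - rm))) (at r)"
    unfolding r_star_eq[abs_def]
    by (intro DERIV_add DERIV_diff DERIV_ident DERIV_cmult has_real_derivative_ln_abs assms)
  moreover have "1 + rp\<^sup>2 / (rp - rm) * (1 / (r - rp)) - rm\<^sup>2 / (rp - rm) * (1 / (r - rm)) = 1 / F r"
    using assms horizons
    by (subst F_factored) (auto simp: divide_simps, simp add: algebra_simps power2_eq_square)
  ultimately show ?thesis by simp
qed

lemma F_neg: "rm < r \<Longrightarrow> r < rp \<Longrightarrow> F r < 0"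
  using horizons by (subst F_factored) (auto simp: divide_neg_pos mult_neg_pos)

lemma F_pos: "rp < r \<Longrightarrow> 0 < F r"
  using horizons by (subst F_factored) auto

lemma F_rp: "F rp = 0"
  using horizons by (subst F_factored) auto

section \<open>Monotonicity and range of the tortoise coordinate, and its inverses\<close>

lemma r_star_decreasing:
  assumes "rm < r" "r < s" "s < rp"
  shows "r_star M e s < r_star M e r"
proof (rule DERIV_neg_imp_decreasing[OF assms(2)])
  fix x assume "r \<le> x" "x \<le> s"
  then have "(r_star M e has_real_derivative 1 / F x) (at x)" "1 / F x < 0"
    using assms horizons F_neg[of x] by (auto intro!: r_star_has_derivative)
  then show "\<exists>y. (r_star M e has_real_derivative y) (at x) \<and> y < 0" by blast
qed

lemma r_star_increasing:
  assumes "rp < r" "r < s"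
  shows "r_star M e r < r_star M e s"
proof (rule DERIV_pos_imp_increasing[OF assms(2)])
  fix x assume "r \<le> x" "x \<le> s"
  then have "(r_star M e has_real_derivative 1 / F x) (at x)" "0 < 1 / F x"
    using assms horizons F_pos[of x] by (auto intro!: r_star_has_derivative)
  then show "\<exists>y. (r_star M e has_real_derivative y) (at x) \<and> 0 < y" by blast
qed

lemma r_star_inj: "inj_on (r_star M e) {rm<..<rp}" "inj_on (r_star M e) {rp<..}"
proof -
  show "inj_on (r_star M e) {rm<..<rp}"
  proof (rule linorder_inj_onI)
    fix x y assume "x < y" "x \<in> {rm<..<rp}" "y \<in> {rm<..<rp}"
    then show "r_star M e x \<noteq> r_star M e y" using r_star_decreasing[of x y] by auto
  qed auto
  show "inj_on (r_star M e) {rp<..}"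
  proof (rule linorder_inj_onI)
    fix x y assume "x < y" "x \<in> {rp<..}" "y \<in> {rp<..}"
    then show "r_star M e x \<noteq> r_star M e y" using r_star_increasing[of x y] by auto
  qed auto
qed

text \<open>The logarithm at \<open>rp\<close> has a positive coefficient and all other terms stay
  bounded, so \<open>r_star\<close> tends to minus infinity. The set \<open>S\<close> is left open
  to serve both sides of the event horizon.\<close>

lemma r_star_near_rp: 
  assumes "at rp within S \<noteq> bot" 
  shows "\<exists>r\<in>S - {rp}. r_star M e r \<le> y"
proof -
  have "filterlim (\<lambda>r. \<bar>r - rp\<bar>) (at_right 0) (at rp within S)"
    by (auto simp: filterlim_at eventually_at_filter intro!: tendsto_eq_intros)
  then have "filterlim (\<lambda>r. ln \<bar>r - rp\<bar>) at_bot (at rp within S)"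
    by (rule filterlim_compose[OF ln_at_0])
  then have "filterlim (\<lambda>r. rp\<^sup>2 / (rp - rm) * ln \<bar>r - rp\<bar>) at_bot (at rp within S)"
    using horizons by (intro filterlim_tendsto_pos_mult_at_bot[OF tendsto_const]) auto
  then have "filterlim (\<lambda>r. (r - rm\<^sup>2 / (rp - rm) * ln \<bar>r - rm\<bar>) + rp\<^sup>2 / (rp - rm) * ln \<bar>r - rp\<bar>) at_bot (at rp within S)"
    by (subst filterlim_tendsto_add_at_bot_iff[where c = "rp - rm\<^sup>2 / (rp - rm) * ln \<bar>rp - rm\<bar>"])
       (use horizons in \<open>auto intro!: tendsto_eq_intros\<close>)
  then have "\<forall>\<^sub>F r in at rp within S. r_star M e r \<le> y"
    by (auto simp: filterlim_at_bot r_star_eq algebra_simps)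
  then have "\<forall>\<^sub>F r in at rp within S. r_star M e r \<le> y \<and> r \<in> S - {rp}"
    by (simp add: eventually_at_filter eventually_mono)
  then show ?thesis using eventually_happens assms by blast
qed

text \<open>Here the diverging logarithm has a negative coefficient, so \<open>r_star\<close> tends
  to plus infinity.\<close>

lemma r_star_near_rm: "\<exists>r\<in>{rm<..<rp}. y \<le> r_star M e r"
proof -
  have "filterlim (\<lambda>r. \<bar>r - rm\<bar>) (at_right 0) (at_right rm)"
    by (auto simp: filterlim_at eventually_at_filter intro!: tendsto_eq_intros)
  then have "filterlim (\<lambda>r. ln \<bar>r - rm\<bar>) at_bot (at_right rm)"
    by (rule filterlim_compose[OF ln_at_0])
  then have "filterlim (\<lambda>r. (- (rm\<^sup>2 / (rp - rm))) * ln \<bar>r - rm\<bar>) at_top (at_right rm)"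
    using horizons by (subst filterlim_tendsto_neg_mult_at_top_iff[OF tendsto_const]) auto
  then have "filterlim (\<lambda>r. (r + rp\<^sup>2 / (rp - rm) * ln \<bar>r - rp\<bar>) + (- (rm\<^sup>2 / (rp - rm))) * ln \<bar>r - rm\<bar>) at_top (at_right rm)"
    by (rule filterlim_tendsto_add_at_top[where c = "rm + rp\<^sup>2 / (rp - rm) * ln \<bar>rm - rp\<bar>", rotated])
       (use horizons in \<open>auto intro!: tendsto_eq_intros\<close>)
  then have "\<forall>\<^sub>F r in at_right rm. y \<le> r_star M e r"
    by (auto simp: filterlim_at_top r_star_eq algebra_simps)
  moreover have "\<forall>\<^sub>F r in at_right rm. r \<in> {rm<..<rp}"
    using horizons by (intro eventually_at_right_real)
  ultimately have "\<forall>\<^sub>F r in at_right rm. y \<le> r_star M e r \<and> r \<in> {rm<..<rp}"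
    by eventually_elim auto
  then show ?thesis using eventually_happens trivial_limit_at_right_real by blast
qed

lemma r_star_near_infinity: "\<exists>r\<in>{rp<..}. y \<le> r_star M e r"
proof -
  define d where "d = rm\<^sup>2 / (rp - rm)"
  have d: "d > 0" using horizons by (simp add: d_def)
  \<comment> \<open>\<open>r \<ge> rp + 1\<close> makes the logarithm at \<open>rp\<close>
    nonnegative. The negative logarithm costs at most
    \<open>r / 2 + d * \<bar>ln (2 * d)\<bar>\<close>, and the second entry of the maximum lets the
    remaining \<open>r / 2\<close> cover \<open>y\<close> and the constant.\<close>
  define r where "r = max (rp + 1) (2 * (y + d * \<bar>ln (2 * d)\<bar>))"
  have r: "r \<ge> rp + 1" "y + d * \<bar>ln (2 * d)\<bar> \<le> r / 2" by (auto simp: r_def)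
  have "ln ((r - rm) / (2 * d)) \<le> (r - rm) / (2 * d)"
    using r d horizons by (intro ln_bound) auto
  then have "d * ln (r - rm) \<le> d * ((r - rm) / (2 * d) + ln (2 * d))"
    using r d horizons by (intro mult_left_mono) (auto simp: ln_div)
  also have "\<dots> \<le> r / 2 + d * ln (2 * d)" using d horizons by (simp add: field_simps)
  also have "\<dots> \<le> r / 2 + d * \<bar>ln (2 * d)\<bar>" using d by simp
  finally have "d * ln (r - rm) \<le> r / 2 + d * \<bar>ln (2 * d)\<bar>" .
  moreover have "0 \<le> rp\<^sup>2 / (rp - rm) * ln (r - rp)"
    using r horizons by (intro mult_nonneg_nonneg) auto
  moreover have "r_star M e r = r + rp\<^sup>2 / (rp - rm) * ln (r - rp) - d * ln (r - rm)"
    using r horizons by (simp add: r_star_eq d_def)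
  ultimately have "y \<le> r_star M e r"
    using r(2) by linarith
  then show ?thesis using r by auto
qed

lemma r_star_continuous:
  assumes "S \<subseteq> {0<..} - {rm, rp}"
  shows "continuous_on S (r_star M e)"
proof (rule DERIV_continuous_on)
  fix r assume "r \<in> S"
  then show "(r_star M e has_real_derivative 1 / F r) (at r within S)"
    using assms by (intro has_field_derivative_at_within[OF r_star_has_derivative]) auto
qed

lemma r_star_image: "r_star M e ` {rm<..<rp} = UNIV" "r_star M e ` {rp<..} = UNIV"
proof -
  have "at_left rp = at rp within {rm<..<rp}"
    using horizons by (intro at_within_nhd[of _ "{rm<..}"]) auto
  then have nb: "at rp within {rm<..<rp} \<noteq> bot" using trivial_limit_at_left_real[of rp] by simp
  show "r_star M e ` {rm<..<rp} = UNIV"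
  proof (rule continuous_image_eq_UNIV)
    show "continuous_on {rm<..<rp} (r_star M e)"
      using horizons by (intro r_star_continuous) auto
    show "\<exists>r\<in>{rm<..<rp}. r_star M e r \<le> y" for y
      using r_star_near_rp[OF nb, of y] by blast
    show "\<exists>r\<in>{rm<..<rp}. y \<le> r_star M e r" for y
      by (rule r_star_near_rm)
  qed simp
  show "r_star M e ` {rp<..} = UNIV"
  proof (rule continuous_image_eq_UNIV)
    show "continuous_on {rp<..} (r_star M e)"
      using horizons by (intro r_star_continuous) auto
    show "\<exists>r\<in>{rp<..}. r_star M e r \<le> y" for y
      using r_star_near_rp[of "{rp<..}" y] by auto
    show "\<exists>r\<in>{rp<..}. y \<le> r_star M e r" for y
      by (rule r_star_near_infinity)
  qed simp
qed

lemma R_int_mem: "rm < R_int x" "R_int x < rp" "0 < R_int x"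
  using the_inv_into_into[OF r_star_inj(1), of x "{rm<..<rp}"] r_star_image horizons by auto

lemma R_ext_mem: "rp < R_ext x" "0 < R_ext x"
  using the_inv_into_into[OF r_star_inj(2), of x "{rp<..}"] r_star_image horizons by auto

lemma r_star_R: "r_star M e (R_int x) = x" "r_star M e (R_ext x) = x"
  using f_the_inv_into_f[OF r_star_inj(1), of x] f_the_inv_into_f[OF r_star_inj(2), of x] r_star_image
  by auto

lemma R_int_has_derivative: "(R_int has_real_derivative F (R_int x)) (at x)"
proof (rule the_inv_into_has_real_derivative[OF _ r_star_inj(1) r_star_image(1)])
  fix r assume r: "r \<in> {rm<..<rp}"
  then show "(r_star M e has_real_derivative 1 / F r) (at r)"
    using horizons by (intro r_star_has_derivative) auto
  show "F r \<noteq> 0" using r F_neg[of r] by auto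
qed simp

lemma R_ext_has_derivative: "(R_ext has_real_derivative F (R_ext x)) (at x)"
proof (rule the_inv_into_has_real_derivative[OF _ r_star_inj(2) r_star_image(2)])
  fix r assume r: "r \<in> {rp<..}"
  then show "(r_star M e has_real_derivative 1 / F r) (at r)"
    using horizons by (intro r_star_has_derivative) auto
  show "F r \<noteq> 0" using r F_pos[of r] by auto
qed simp

section \<open>Asymptotics of the radius and of the metric coefficient at the horizons\<close>

lemma R_int_tendsto: "(R_int \<longlongrightarrow> rp) at_bot"
proof (rule order_tendstoI)
  fix y assume "y < rp"
  \<comment> \<open>\<open>y\<close> may lie below \<open>rm\<close>; the maximum with the midpoint
    gives a point of the interior, where monotonicity of \<open>r_star\<close> applies.\<close>
  define z where "z = max y ((rm + rp) / 2)"
  have z: "rm < z" "z < rp" "y \<le> z" using \<open>y < rp\<close> horizons by (auto simp: z_def field_simps less_max_iff_disj)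
  have "\<forall>\<^sub>F x in at_bot. x < r_star M e z" by (rule eventually_gt_at_bot)
  then show "\<forall>\<^sub>F x in at_bot. y < R_int x"
  proof eventually_elim
    case (elim x)
    then show ?case
      using r_star_decreasing[of "R_int x" z] R_int_mem[of x] r_star_R(1)[of x] z
      by (cases "R_int x" z rule: linorder_cases) auto
  qed
next
  fix y assume "rp < y"
  then show "\<forall>\<^sub>F x in at_bot. R_int x < y"
    using R_int_mem by (intro always_eventually) (metis order_less_trans)
qed

lemma R_ext_tendsto: "(R_ext \<longlongrightarrow> rp) at_bot"
proof (rule order_tendstoI)
  fix y assume y: "rp < y"
  have "\<forall>\<^sub>F x in at_bot. x < r_star M e y" by (rule eventually_gt_at_bot)
  then show "\<forall>\<^sub>F x in at_bot. R_ext x < y"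
  proof eventually_elim
    case (elim x)
    then show ?case
      using r_star_increasing[of y "R_ext x"] R_ext_mem[of x] r_star_R(2)[of x] y
      by (cases "R_ext x" y rule: linorder_cases) auto
  qed
next
  fix y assume "y < rp"
  then show "\<forall>\<^sub>F x in at_bot. y < R_ext x"
    using R_ext_mem by (intro always_eventually) (metis order_less_trans)
qed

text \<open>In the formula for \<open>r_star\<close> each logarithm is at most
  \<open>ln \<Delta>\<close>, so \<open>rp - r\<close> decays like \<open>exp (x / c)\<close> for
  negative \<open>x\<close>, and \<open>r - rm\<close> like \<open>exp (- x / c')\<close> for
  positive \<open>x\<close>. Up to constants \<open>- F\<close> is bounded by the smaller of these
  distances. Since \<open>c' \<le> c\<close>, the common rate is \<open>1 / c\<close>, the
  derivative of \<open>F\<close> at \<open>rp\<close>.\<close>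

lemma F_R_int_decay:
  obtains A \<kappa> where "\<kappa> > 0" "A > 0" "\<And>x. - F (R_int x) \<le> A * exp (- \<kappa> * \<bar>x\<bar>)"
proof -
  define \<Delta> where "\<Delta> = rp - rm"
  define c where "c = rp\<^sup>2 / \<Delta>"
  define c' where "c' = rm\<^sup>2 / \<Delta>"
  have pos: "\<Delta> > 0" "c > 0" "c' > 0" using horizons by (auto simp: \<Delta>_def c_def c'_def)
  have "c' \<le> c" using horizons pos unfolding c_def c'_def
    by (intro divide_right_mono power_mono) auto
  \<comment> \<open>Exponentials of the constants left after solving the formula for
    \<open>x\<close> for \<open>ln (rp - r)\<close> when \<open>x \<le> 0\<close>, respectively for
    \<open>ln (r - rm)\<close> when \<open>x > 0\<close>.\<close>
  define A1 where "A1 = exp (c' * ln \<Delta> / c)"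
  define A2 where "A2 = exp ((rp + c * ln \<Delta>) / c')"
  show thesis
  proof (rule that)
    have "A1 + A2 > 0" by (simp add: A1_def A2_def add_pos_pos)
    then show "1 / c > 0" "\<Delta> / rm\<^sup>2 * (A1 + A2) > 0" using pos horizons by simp_all
    fix x
    define r where "r = R_int x"
    have r: "rm < r" "r < rp" "0 < r" using R_int_mem by (auto simp: r_def)
    have x: "x = r + c * ln (rp - r) - c' * ln (r - rm)"
      using r_star_R(1)[of x] r by (simp add: r_star_eq r_def[symmetric] c_def c'_def \<Delta>_def abs_minus_commute)
    have ln_le: "c' * ln (r - rm) \<le> c' * ln \<Delta>" "c * ln (rp - r) \<le> c * ln \<Delta>"
      using r pos by (auto simp: \<Delta>_def intro!: mult_left_mono)
    have m: "min (rp - r) (r - rm) \<le> (A1 + A2) * exp (- (1 / c) * \<bar>x\<bar>)"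
    proof (cases "x \<le> 0")
      case True
      have "c * ln (rp - r) \<le> x + c' * ln \<Delta>" using x ln_le r by linarith
      then have "ln (rp - r) \<le> (1 / c) * x + c' * ln \<Delta> / c" using pos by (simp add: field_simps)
      then have "rp - r \<le> exp ((1 / c) * x + c' * ln \<Delta> / c)"
        using r by (metis diff_gt_0_iff_gt exp_le_cancel_iff exp_ln)
      also have "\<dots> = A1 * exp (- (1 / c) * \<bar>x\<bar>)" using True by (simp add: exp_add A1_def)
      also have "\<dots> \<le> (A1 + A2) * exp (- (1 / c) * \<bar>x\<bar>)" by (simp add: A2_def)
      finally show ?thesis by linarith
    next
      case False
      have "c' * ln (r - rm) \<le> - x + (rp + c * ln \<Delta>)" using x ln_le r by linarith
      then have "ln (r - rm) \<le> (- x + (rp + c * ln \<Delta>)) / c'"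
        using pos by (simp add: pos_le_divide_eq mult.commute)
      also have "\<dots> = - (1 / c') * x + (rp + c * ln \<Delta>) / c'" by (simp add: add_divide_distrib diff_divide_distrib)
      finally have "ln (r - rm) \<le> - (1 / c') * x + (rp + c * ln \<Delta>) / c'" .
      also have "\<dots> \<le> - (1 / c) * x + (rp + c * ln \<Delta>) / c'"
        using False pos \<open>c' \<le> c\<close> by (auto intro!: divide_left_mono)
      finally have "r - rm \<le> exp (- (1 / c) * x + (rp + c * ln \<Delta>) / c')"
        using r by (metis diff_gt_0_iff_gt exp_le_cancel_iff exp_ln)
      also have "\<dots> = A2 * exp (- (1 / c) * \<bar>x\<bar>)" using False by (simp only: exp_add A2_def) simp
      also have "\<dots> \<le> (A1 + A2) * exp (- (1 / c) * \<bar>x\<bar>)" by (simp add: A1_def)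
      finally show ?thesis by linarith
    qed
    have "- F r = (rp - r) * (r - rm) / r\<^sup>2" using r by (subst F_factored) (auto simp: field_simps)
    also have "\<dots> \<le> (rp - r) * (r - rm) / rm\<^sup>2"
      using r horizons by (intro divide_left_mono power_mono) auto
    also have "(rp - r) * (r - rm) \<le> \<Delta> * min (rp - r) (r - rm)"
    proof (cases "rp - r \<le> r - rm")
      case True
      then show ?thesis using r mult_right_mono[of "r - rm" \<Delta> "rp - r"]
        by (simp add: \<Delta>_def mult.commute)
    next
      case False
      then show ?thesis using r mult_right_mono[of "rp - r" \<Delta> "r - rm"]
        by (simp add: \<Delta>_def)
    qed
    also have "\<dots> \<le> \<Delta> * ((A1 + A2) * exp (- (1 / c) * \<bar>x\<bar>))"
      using m pos by (intro mult_left_mono) auto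
    finally show "- F (R_int x) \<le> \<Delta> / rm\<^sup>2 * (A1 + A2) * exp (- (1 / c) * \<bar>x\<bar>)"
      by (simp add: r_def divide_right_mono)
  qed
qed

end

section \<open>Spherical waves in the interior\<close>

context subextremal
begin

lemma r_int_eq: "r_int M e u v = R_int (v + u)" and r_ext_eq: "r_ext M e u v = R_ext (v - u)"
  by (simp_all add: r_int_def r_ext_def)

lemma R_int_continuous: "continuous_on S f \<Longrightarrow> continuous_on S (\<lambda>x. R_int (f x))"
  by (rule continuous_on_compose2[OF DERIV_continuous_on[OF R_int_has_derivative]]) auto

lemma F_continuous: "continuous_on S f \<Longrightarrow> (\<And>x. x \<in> S \<Longrightarrow> f x \<noteq> 0) \<Longrightarrow> continuous_on S (\<lambda>x. F (f x))"
  unfolding rn_F_def by (intro continuous_intros) auto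

lemma pd_r_int:
  assumes "u \<le> -1" "v \<ge> 1"
  shows "pd_v (r_int M e) u v = F (R_int (v + u))" "pd_u {..-1} (r_int M e) u v = F (R_int (v + u))"
proof -
  have "((\<lambda>v. R_int (v + u)) has_real_derivative F (R_int (v + u))) (at v within {1..})"
  proof -
    have "((\<lambda>v. v + u) has_real_derivative 1) (at v within {1..})"
      by (auto intro!: derivative_eq_intros)
    from DERIV_chain2[OF R_int_has_derivative this] show ?thesis by simp
  qed
  then show "pd_v (r_int M e) u v = F (R_int (v + u))"
    unfolding pd_v_def r_int_eq
    using vector_derivative_within[OF at_within_ray_ne_bot(1)] assms
    by (auto simp: has_real_derivative_iff_has_vector_derivative)
  have "((\<lambda>u. R_int (v + u)) has_real_derivative F (R_int (v + u))) (at u within {..-1})"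
  proof -
    have "((\<lambda>u. v + u) has_real_derivative 1) (at u within {..-1})"
      by (auto intro!: derivative_eq_intros)
    from DERIV_chain2[OF R_int_has_derivative this] show ?thesis by simp
  qed
  then show "pd_u {..-1} (r_int M e) u v = F (R_int (v + u))"
    unfolding pd_u_def r_int_eq
    using vector_derivative_within[OF at_within_ray_ne_bot(2)] assms
    by (auto simp: has_real_derivative_iff_has_vector_derivative)
qed

text \<open>Chain rule along a curve \<open>(p, q)\<close> that stays in a set which need not be
  open; derivatives are taken within \<open>S\<close> and \<open>T\<close>, so boundary points are
  included.\<close>

lemma chain_rule_in_region:
  fixes \<phi> :: "real \<times> real \<Rightarrow> real" and \<phi>' :: "real \<times> real \<Rightarrow> (real \<times> real) \<Rightarrow>\<^sub>L real"
  assumes d: "\<And>x. x \<in> S \<Longrightarrow> (\<phi> has_derivative \<phi>' x) (at x within S)"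
    and "\<And>s. s \<in> T \<Longrightarrow> (p s, q s) \<in> S" "t \<in> T"
    and p: "(p has_real_derivative p') (at t within T)" and q: "(q has_real_derivative q') (at t within T)"
  shows "((\<lambda>s. \<phi> (p s, q s)) has_real_derivative \<phi>' (p t, q t) (p', q')) (at t within T)"
proof -
  have "((\<lambda>s. (p s, q s)) has_derivative (\<lambda>y. (p' * y, q' * y))) (at t within T)"
    using p q by (intro has_derivative_Pair) (auto simp: has_field_derivative_def)
  from has_derivative_in_compose2[OF d _ \<open>t \<in> T\<close> this]
  have "((\<lambda>s. \<phi> (p s, q s)) has_derivative (\<lambda>y. \<phi>' (p t, q t) (p' * y, q' * y))) (at t within T)"
    using assms(2) by auto
  moreover have "(\<lambda>y. \<phi>' (p t, q t) (p' * y, q' * y)) = (*) (\<phi>' (p t, q t) (p', q'))"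
    using blinfun.scaleR_right[of "\<phi>' (p t, q t)" _ "(p', q')"] by (auto simp: mult.commute)
  ultimately show ?thesis by (simp add: has_field_derivative_def)
qed

lemma region_mem:
  "u \<le> -1 \<Longrightarrow> v \<ge> 1 \<Longrightarrow> (v, R_int (v + u)) \<in> rn_region M e U0"
  "u \<ge> - U0 \<Longrightarrow> v \<ge> 1 \<Longrightarrow> (v, R_ext (v - u)) \<in> rn_region M e U0"
  "v \<ge> 1 \<Longrightarrow> (v, rp) \<in> rn_region M e U0"
  unfolding rn_region_def r_int_eq r_ext_eq by blast+

section \<open>Null derivatives up to the event horizon\<close>

context
  fixes \<phi> :: "real \<times> real \<Rightarrow> real" and \<phi>' :: "real \<times> real \<Rightarrow> (real \<times> real) \<Rightarrow>\<^sub>L real" and U0 :: real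
  assumes \<phi>': "\<And>x. x \<in> rn_region M e U0 \<Longrightarrow> (\<phi> has_derivative \<phi>' x) (at x within rn_region M e U0)"
    and \<phi>'_cont: "continuous_on (rn_region M e U0) \<phi>'"
begin

text \<open>In the chart \<open>(v, r)\<close> the null derivatives are directional: along
  \<open>(1, F)\<close> at fixed \<open>u\<close> and along \<open>(0, F)\<close> at fixed
  \<open>v\<close>, because \<open>R_int\<close> has derivative \<open>F\<close> of itself.\<close>

lemma in_int_has_derivative:
  assumes "u \<le> -1" "v \<ge> 1"
  shows "((\<lambda>v. in_int M e \<phi> u v) has_real_derivative pd_v (in_int M e \<phi>) u v) (at v within {1..})"
    "((\<lambda>u. in_int M e \<phi> u v) has_real_derivative pd_u {..-1} (in_int M e \<phi>) u v) (at u within {..-1})"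
    "pd_v (in_int M e \<phi>) u v = \<phi>' (v, R_int (v + u)) (1, F (R_int (v + u)))"
    "pd_u {..-1} (in_int M e \<phi>) u v = \<phi>' (v, R_int (v + u)) (0, F (R_int (v + u)))"
proof -
  have "((\<lambda>v. v + u) has_real_derivative 1) (at v within {1..})"
    by (auto intro!: derivative_eq_intros)
  from DERIV_chain2[OF R_int_has_derivative this]
  have v: "((\<lambda>v. in_int M e \<phi> u v) has_real_derivative \<phi>' (v, R_int (v + u)) (1, F (R_int (v + u)))) (at v within {1..})"
    unfolding in_int_def r_int_eq
    by (intro chain_rule_in_region[OF \<phi>']) (use assms region_mem in auto)
  then show v': "pd_v (in_int M e \<phi>) u v = \<phi>' (v, R_int (v + u)) (1, F (R_int (v + u)))"
    unfolding pd_v_def has_real_derivative_iff_has_vector_derivative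
    by (intro vector_derivative_within at_within_ray_ne_bot assms)
  show "((\<lambda>v. in_int M e \<phi> u v) has_real_derivative pd_v (in_int M e \<phi>) u v) (at v within {1..})"
    unfolding v' by (rule v)
  have "((\<lambda>u. v + u) has_real_derivative 1) (at u within {..-1})"
    by (auto intro!: derivative_eq_intros)
  from DERIV_chain2[OF R_int_has_derivative this]
  have u: "((\<lambda>u. in_int M e \<phi> u v) has_real_derivative \<phi>' (v, R_int (v + u)) (0, F (R_int (v + u)))) (at u within {..-1})"
    unfolding in_int_def r_int_eq
    by (intro chain_rule_in_region[OF \<phi>']) (use assms region_mem in auto)
  then show u': "pd_u {..-1} (in_int M e \<phi>) u v = \<phi>' (v, R_int (v + u)) (0, F (R_int (v + u)))"
    unfolding pd_u_def has_real_derivative_iff_has_vector_derivative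
    by (intro vector_derivative_within at_within_ray_ne_bot assms)
  show "((\<lambda>u. in_int M e \<phi> u v) has_real_derivative pd_u {..-1} (in_int M e \<phi>) u v) (at u within {..-1})"
    unfolding u' by (rule u)
qed

lemma in_int_pd_continuous:
  "continuous_on ({..-1} \<times> {1..}) (\<lambda>(u, v). pd_v (in_int M e \<phi>) u v)"
  "continuous_on ({..-1} \<times> {1..}) (\<lambda>(u, v). pd_u {..-1} (in_int M e \<phi>) u v)"
proof -
  have p: "continuous_on ({..-1} \<times> {1..}) (\<lambda>x::real \<times> real. (snd x, R_int (snd x + fst x)))"
    by (intro continuous_intros R_int_continuous)
  have c: "continuous_on ({..-1} \<times> {1..}) (\<lambda>x::real \<times> real. \<phi>' (snd x, R_int (snd x + fst x)))"
    by (rule continuous_on_compose2[OF \<phi>'_cont p]) (use region_mem in auto)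
  have f: "continuous_on ({..-1} \<times> {1..}) (\<lambda>x::real \<times> real. F (R_int (snd x + fst x)))"
    by (intro F_continuous R_int_continuous continuous_intros) (use R_int_mem in \<open>auto simp: less_le\<close>)
  have *: "continuous_on ({..-1} \<times> {1..})
      (\<lambda>x::real \<times> real. \<phi>' (snd x, R_int (snd x + fst x)) (c, F (R_int (snd x + fst x))))" for c
    by (intro continuous_intros c f)
  show "continuous_on ({..-1} \<times> {1..}) (\<lambda>(u, v). pd_v (in_int M e \<phi>) u v)"
    by (rule continuous_on_eq[OF *[of 1]]) (auto simp: in_int_has_derivative)
  show "continuous_on ({..-1} \<times> {1..}) (\<lambda>(u, v). pd_u {..-1} (in_int M e \<phi>) u v)"
    by (rule continuous_on_eq[OF *[of 0]]) (auto simp: in_int_has_derivative)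
qed

text \<open>As \<open>u\<close> tends to minus infinity at fixed \<open>v\<close>, the radius tends
  to \<open>rp\<close> and \<open>F\<close> to 0, so the direction \<open>(1, F)\<close> becomes the
  horizon tangent \<open>(1, 0)\<close>.\<close>

lemma pd_v_in_int_tendsto:
  assumes "v \<ge> 1"
  shows "((\<lambda>u. pd_v (in_int M e \<phi>) u v) \<longlongrightarrow> \<phi>' (v, rp) (1, 0)) at_bot"
proof -
  have ev: "\<forall>\<^sub>F u in at_bot. u \<le> (-1::real)" by (rule eventually_le_at_bot)
  have "filterlim (\<lambda>u. v + u) at_bot at_bot"
    by (intro filterlim_tendsto_add_at_bot_iff[THEN iffD2, OF tendsto_const] filterlim_ident)
  then have R: "((\<lambda>u. R_int (v + u)) \<longlongrightarrow> rp) at_bot"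
    by (rule filterlim_compose[OF R_int_tendsto])
  have F: "((\<lambda>u. F (R_int (v + u))) \<longlongrightarrow> 0) at_bot"
    unfolding F_rp[symmetric] rn_F_def
    by (intro tendsto_intros R) (use horizons in auto)
  have "((\<lambda>u. \<phi>' (v, R_int (v + u))) \<longlongrightarrow> \<phi>' (v, rp)) at_bot"
    by (rule continuous_on_tendsto_compose[OF \<phi>'_cont])
       (use assms region_mem eventually_mono[OF ev] in \<open>auto intro!: tendsto_intros R\<close>)
  then have "((\<lambda>u. \<phi>' (v, R_int (v + u)) (1, F (R_int (v + u)))) \<longlongrightarrow> \<phi>' (v, rp) (1, 0)) at_bot"
    by (intro tendsto_intros F)
  then show ?thesis
    by (rule Lim_transform_eventually)
       (use assms in \<open>auto simp: in_int_has_derivative intro: eventually_mono[OF ev]\<close>)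
qed

text \<open>The same limit from the exterior. It identifies \<open>dv_horizon\<close>, defined from
  outside, with the limit reached by the interior estimate.\<close>

lemma dv_horizon_eq:
  assumes "v \<ge> 1"
  shows "dv_horizon M e \<phi> v = \<phi>' (v, rp) (1, 0)"
proof -
  have ev: "\<forall>\<^sub>F u in at_top. u \<ge> - U0" by (rule eventually_ge_at_top)
  have "filterlim (\<lambda>u. v + - u) at_bot at_top"
    by (intro filterlim_tendsto_add_at_bot_iff[THEN iffD2, OF tendsto_const] filterlim_uminus_at_bot_at_top)
  then have "filterlim (\<lambda>u. v - u) at_bot at_top" by simp
  then have R: "((\<lambda>u. R_ext (v - u)) \<longlongrightarrow> rp) at_top"
    by (rule filterlim_compose[OF R_ext_tendsto])
  have F: "((\<lambda>u. F (R_ext (v - u))) \<longlongrightarrow> 0) at_top"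
    unfolding F_rp[symmetric] rn_F_def
    by (intro tendsto_intros R) (use horizons in auto)
  have "((\<lambda>u. \<phi>' (v, R_ext (v - u))) \<longlongrightarrow> \<phi>' (v, rp)) at_top"
    by (rule continuous_on_tendsto_compose[OF \<phi>'_cont])
       (use assms region_mem eventually_mono[OF ev] in \<open>auto intro!: tendsto_intros R\<close>)
  then have "((\<lambda>u. \<phi>' (v, R_ext (v - u)) (1, F (R_ext (v - u)))) \<longlongrightarrow> \<phi>' (v, rp) (1, 0)) at_top"
    by (intro tendsto_intros F)
  moreover have "\<phi>' (v, R_ext (v - u)) (1, F (R_ext (v - u))) = pd_v (in_ext M e \<phi>) u v" if "u \<ge> - U0" for u
  proof -
    have "((\<lambda>v. v - u) has_real_derivative 1) (at v within {1..})"
      by (auto intro!: derivative_eq_intros)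
    from DERIV_chain2[OF R_ext_has_derivative this]
    have "((\<lambda>v. in_ext M e \<phi> u v) has_real_derivative \<phi>' (v, R_ext (v - u)) (1, F (R_ext (v - u)))) (at v within {1..})"
      unfolding in_ext_def r_ext_eq
      by (intro chain_rule_in_region[OF \<phi>']) (use assms that region_mem in auto)
    then show ?thesis
      unfolding pd_v_def has_real_derivative_iff_has_vector_derivative
      by (intro vector_derivative_within[symmetric] at_within_ray_ne_bot assms)
  qed
  ultimately have "((\<lambda>u. pd_v (in_ext M e \<phi>) u v) \<longlongrightarrow> \<phi>' (v, rp) (1, 0)) at_top"
    by (elim Lim_transform_eventually) (auto intro: eventually_mono[OF ev])
  then show ?thesis
    unfolding dv_horizon_def by (intro tendsto_Lim trivial_limit_at_top_linorder)
qed

lemma dv_horizon_continuous: "continuous_on {1..} (dv_horizon M e \<phi>)"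
proof -
  have "continuous_on {1..} (\<lambda>v. \<phi>' (v, rp))"
    by (rule continuous_on_compose2[OF \<phi>'_cont]) (use region_mem in \<open>auto intro!: continuous_intros\<close>)
  then have "continuous_on {1..} (\<lambda>v. \<phi>' (v, rp) (1, 0))" by (intro continuous_intros)
  then show ?thesis by (rule continuous_on_eq) (simp add: dv_horizon_eq)
qed

text \<open>The hypotheses on \<open>u = u0\<close> and \<open>v = 1\<close> feed
  \<open>goursat_weighted_energy\<close>, which bounds the weighted fluxes through all lines
  \<open>u = u0 - k\<close> by one constant; \<open>k \<rightarrow> \<infinity>\<close> reaches the
  horizon.\<close>

lemma horizon_weighted_integrable:
  assumes wave: "wave_eq {..-1} (r_int M e) (in_int M e \<phi>)"
    and data: "\<And>u. u \<le> -1 \<Longrightarrow> \<bar>pd_u {..-1} (in_int M e \<phi>) u 1 / pd_u {..-1} (r_int M e) u 1\<bar> \<le> D"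
    and u0: "u0 \<le> -1"
    and int: "set_integrable lborel {1..}
      (\<lambda>v. (ln (1 / Omega_int M e u0 v)) ^ n * (pd_v (in_int M e \<phi>) u0 v)\<^sup>2)"
  shows "set_integrable lborel {1..} (\<lambda>v. v ^ n * (dv_horizon M e \<phi> v)\<^sup>2)"
proof -
  let ?g = "in_int M e \<phi>" and ?I = "{..-1::real}"
  \<comment> \<open>Multiplication by the radius removes the self-interaction: the derivative
    \<open>F\<close> of \<open>R_int\<close> cancels the \<open>pd_v\<close> term in the
    \<open>u\<close>-equation, and likewise the \<open>pd_u\<close> term in the
    \<open>v\<close>-equation, leaving only the coupling \<open>c\<close>.\<close>
  define a where "a = (\<lambda>u v. R_int (v + u) * pd_v ?g u v)"
  define b where "b = (\<lambda>u v. R_int (v + u) * pd_u ?I ?g u v)"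
  define c where "c = (\<lambda>x. - F (R_int x) / R_int x)"
  obtain A \<kappa> where \<kappa>: "\<kappa> > 0" "A > 0" and decay: "\<And>x. - F (R_int x) \<le> A * exp (- \<kappa> * \<bar>x\<bar>)"
    by (rule F_R_int_decay) blast
  have F_neg': "F (R_int x) < 0" for x using F_neg R_int_mem by blast
  have wave_deriv: "((\<lambda>u. pd_v ?g u v) has_real_derivative
      - (F (R_int (v + u)) * (pd_u ?I ?g u v + pd_v ?g u v)) / R_int (v + u)) (at u within ?I)"
    if "u \<le> -1" "v \<ge> 1" for u v
  proof -
    have "(\<lambda>u. pd_v ?g u v) differentiable (at u within ?I)"
      using wave that by (auto simp: wave_eq_def)
    then have "((\<lambda>u. pd_v ?g u v) has_real_derivative pd_u ?I (pd_v ?g) u v) (at u within ?I)"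
      unfolding pd_u_def has_real_derivative_iff_has_vector_derivative
      by (simp add: vector_derivative_works)
    moreover have "pd_u ?I (pd_v ?g) u v = - (F (R_int (v + u)) * (pd_u ?I ?g u v + pd_v ?g u v)) / R_int (v + u)"
      using wave that by (simp add: wave_eq_def pd_r_int r_int_eq[of u v] diff_divide_distrib add_divide_distrib distrib_left)
    ultimately show ?thesis by simp
  qed
  have cont_v: "continuous_on {1..} (pd_v ?g u)" if "u \<le> -1" for u
    using continuous_on_slice[OF in_int_pd_continuous(1)] that by simp
  have R_cont: "continuous_on S (\<lambda>x. R_int (snd x + fst x))" for S :: "(real \<times> real) set"
    by (intro R_int_continuous continuous_intros)
  have R_nz: "R_int x \<noteq> 0" for x using R_int_mem[of x] by simp
  have F_cont: "continuous_on S (\<lambda>x. F (R_int (snd x + fst x)))" for S :: "(real \<times> real) set"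
    by (intro F_continuous R_cont R_nz)
  have pd_cont: "continuous_on (?I \<times> {1..}) (\<lambda>x. pd_v ?g (fst x) (snd x))"
    "continuous_on (?I \<times> {1..}) (\<lambda>x. pd_u ?I ?g (fst x) (snd x))"
    using in_int_pd_continuous by (auto simp: case_prod_beta)
  have mixed: "((\<lambda>v. pd_u ?I ?g u v) has_real_derivative
      - (F (R_int (v + u)) * (pd_u ?I ?g u v + pd_v ?g u v)) / R_int (v + u)) (at v within {1..})"
    if "u \<le> -1" "v \<ge> 1" for u v
  proof (rule mixed_derivative_swap[where I = ?I and f = ?g and fv = "pd_v ?g"
        and fuv = "\<lambda>u v. - (F (R_int (v + u)) * (pd_u ?I ?g u v + pd_v ?g u v)) / R_int (v + u)"])
    show "continuous_on (?I \<times> {1..})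
        (\<lambda>(u, v). - (F (R_int (v + u)) * (pd_u ?I ?g u v + pd_v ?g u v)) / R_int (v + u))"
      unfolding case_prod_beta by (intro continuous_intros F_cont R_cont pd_cont) (use R_nz in auto)
  qed (use that in_int_has_derivative(1,2) wave_deriv cont_v at_within_ray_ne_bot(2) in auto)
  obtain K0 where K0: "\<And>V. V \<ge> 1 \<Longrightarrow> integral {1..V} (\<lambda>v. v ^ n * (pd_v ?g u0 v)\<^sup>2) \<le> K0"
  proof (rule weighted_integral_bounded[OF int cont_v[OF u0]])
    \<comment> \<open>Decay of \<open>- F\<close> gives \<open>log (1/\<Omega>) \<ge> \<kappa> / 2 *
      (v + u0) - \<bar>ln A\<bar> / 2\<close>. From \<open>V1\<close> on, half of the linear term
      absorbs the constants, leaving the slope \<open>\<kappa> / 4\<close>.\<close>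
    define V1 where "V1 = max 1 ((\<bar>ln A\<bar> / 2 - \<kappa> * u0 / 2) * 4 / \<kappa>)"
    show "\<kappa> / 4 > 0" "V1 \<ge> 1" using \<kappa> by (auto simp: V1_def)
    fix v assume "v \<ge> V1"
    then have "(\<bar>ln A\<bar> / 2 - \<kappa> * u0 / 2) * 4 / \<kappa> \<le> v" by (simp add: V1_def)
    then have v: "\<bar>ln A\<bar> / 2 - \<kappa> * u0 / 2 \<le> \<kappa> / 4 * v" using \<kappa> by (simp add: field_simps)
    define w where "w = - F (R_int (v + u0))"
    have w: "w > 0" using F_neg' by (simp add: w_def)
    have "ln w \<le> ln (A * exp (- \<kappa> * \<bar>v + u0\<bar>))"
      using w decay[of "v + u0"] by (intro ln_mono) (auto simp: w_def)
    also have "\<dots> = ln A - \<kappa> * \<bar>v + u0\<bar>" using \<kappa> by (simp add: ln_mult)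
    also have "\<dots> \<le> \<bar>ln A\<bar> - \<kappa> * (v + u0)" using \<kappa> by (intro diff_mono mult_left_mono) auto
    finally have "\<kappa> / 4 * v \<le> - (ln w / 2)" using v by (simp add: field_simps)
    also have "\<dots> = ln (1 / Omega_int M e u0 v)"
      using w by (simp add: Omega_int_def r_int_eq w_def[symmetric] ln_div ln_sqrt)
    finally show "\<kappa> / 4 * v \<le> ln (1 / Omega_int M e u0 v)" .
  qed blast
  obtain C where C: "\<And>u V. u \<le> u0 \<Longrightarrow> V \<ge> 1 \<Longrightarrow> integral {1..V} (\<lambda>v. v ^ n * (a u v)\<^sup>2) \<le> C"
  proof (rule goursat_weighted_energy[where a = a and b = b and c = c and ?u0.0 = u0 and n = n, OF \<kappa>(1)])
    show "0 \<le> c x" for x using F_neg'[of x] R_int_mem[of x] by (simp add: c_def divide_nonpos_pos)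
    show "c x \<le> A / rm * exp (- \<kappa> * \<bar>x\<bar>)" for x
    proof -
      have "c x \<le> - F (R_int x) / rm"
        unfolding c_def using F_neg'[of x] R_int_mem[of x] horizons by (intro divide_left_mono) auto
      also have "\<dots> \<le> A * exp (- \<kappa> * \<bar>x\<bar>) / rm"
        using decay[of x] horizons by (intro divide_right_mono) auto
      finally show ?thesis by simp
    qed
    show "continuous_on UNIV c"
      unfolding c_def
      by (intro continuous_intros F_continuous R_int_continuous) (use R_nz in auto)
    fix u v :: real assume uv: "u \<le> -1" "v \<ge> 1"
    have "((\<lambda>u. v + u) has_real_derivative 1) (at u within ?I)" "((\<lambda>v. v + u) has_real_derivative 1) (at v within {1..})"
      by (auto intro!: derivative_eq_intros)
    note dR = this[THEN DERIV_chain2[OF R_int_has_derivative]]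
    show "((\<lambda>u. a u v) has_real_derivative c (u + v) * b u v) (at u within ?I)"
      unfolding a_def
      by (rule DERIV_cong[OF DERIV_mult[OF dR(1) wave_deriv[OF uv]]])
         (simp add: b_def c_def R_nz field_simps)
    show "((\<lambda>v. b u v) has_real_derivative c (u + v) * a u v) (at v within {1..})"
      unfolding b_def
      by (rule DERIV_cong[OF DERIV_mult[OF dR(2) mixed[OF uv]]])
         (simp add: a_def c_def R_nz field_simps)
  next
    show "continuous_on (?I \<times> {1..}) (\<lambda>(u, v). a u v)" "continuous_on (?I \<times> {1..}) (\<lambda>(u, v). b u v)"
      unfolding a_def b_def case_prod_beta by (intro continuous_on_mult R_cont pd_cont)+
  next
    fix u :: real assume u: "u \<le> -1"
    \<comment> \<open>On \<open>v = 1\<close> the data bound divides by the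
      \<open>u\<close>-derivative of the radius, which is \<open>F\<close>; multiplying back turns a
      bounded quotient into exponential decay.\<close>
    have "\<bar>pd_u ?I ?g u 1\<bar> / \<bar>F (R_int (1 + u))\<bar> \<le> D"
      using data[OF u] u by (simp add: pd_r_int)
    then have "\<bar>pd_u ?I ?g u 1\<bar> \<le> D * \<bar>F (R_int (1 + u))\<bar>"
      using F_neg'[of "1 + u"] by (subst (asm) pos_divide_le_eq) auto
    also have "\<dots> = D * - F (R_int (1 + u))" using F_neg'[of "1 + u"] by simp
    also have "\<dots> \<le> \<bar>D\<bar> * (A * exp (- \<kappa> * \<bar>1 + u\<bar>))"
      using decay[of "1 + u"] F_neg'[of "1 + u"] by (intro mult_mono) auto
    \<comment> \<open>\<open>u \<le> -1\<close> gives \<open>\<bar>1 + u\<bar> = - 1 - u\<close>,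
      whence the factor \<open>exp \<kappa>\<close>.\<close>
    also have "\<dots> = \<bar>D\<bar> * A * exp \<kappa> * exp (\<kappa> * u)"
      using u by (simp add: exp_add[symmetric] algebra_simps)
    finally have "\<bar>pd_u ?I ?g u 1\<bar> \<le> \<bar>D\<bar> * A * exp \<kappa> * exp (\<kappa> * u)" .
    then have "R_int (1 + u) * \<bar>pd_u ?I ?g u 1\<bar> \<le> rp * (\<bar>D\<bar> * A * exp \<kappa> * exp (\<kappa> * u))"
      using R_int_mem[of "1 + u"] horizons by (intro mult_mono) auto
    then show "\<bar>b u 1\<bar> \<le> rp * (\<bar>D\<bar> * A * exp \<kappa>) * exp (\<kappa> * u)"
      using R_int_mem[of "1 + u"] by (simp add: b_def abs_mult mult_ac)
  next
    show "u0 \<le> -1" by (rule u0)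
    fix V :: real assume V: "V \<ge> 1"
    have a_cont: "continuous_on {1..} (a u0)"
      unfolding a_def by (intro continuous_intros cont_v R_int_continuous u0)
    have "integral {1..V} (\<lambda>v. v ^ n * (a u0 v)\<^sup>2) \<le> integral {1..V} (\<lambda>v. rp\<^sup>2 * (v ^ n * (pd_v ?g u0 v)\<^sup>2))"
    proof (rule integral_le)
      fix v assume "v \<in> {1..V}"
      then have "v ^ n * ((R_int (v + u0))\<^sup>2 * (pd_v ?g u0 v)\<^sup>2) \<le> v ^ n * (rp\<^sup>2 * (pd_v ?g u0 v)\<^sup>2)"
        using R_int_mem[of "v + u0"] by (intro mult_left_mono mult_right_mono power_mono) auto
      then show "v ^ n * (a u0 v)\<^sup>2 \<le> rp\<^sup>2 * (v ^ n * (pd_v ?g u0 v)\<^sup>2)"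
        by (simp add: a_def power_mult_distrib mult_ac)
    qed (intro integrable_continuous_interval continuous_intros continuous_on_subset[OF a_cont]
        continuous_on_subset[OF cont_v[OF u0]]; simp)+
    also have "\<dots> = rp\<^sup>2 * integral {1..V} (\<lambda>v. v ^ n * (pd_v ?g u0 v)\<^sup>2)" by simp
    also have "\<dots> \<le> rp\<^sup>2 * K0" using K0[OF V] by (intro mult_left_mono) auto
    finally show "integral {1..V} (\<lambda>v. v ^ n * (a u0 v)\<^sup>2) \<le> rp\<^sup>2 * K0" .
  qed blast
  \<comment> \<open>Since \<open>a\<close> contains the radius, its limit along
    \<open>u = u0 - k\<close> is \<open>rp * dv_horizon M e \<phi> v\<close>; the nonzero constant
    \<open>rp\<^sup>2\<close> is divided out at the end.\<close>
  have "set_integrable lborel {1..} (\<lambda>v. v ^ n * (rp * dv_horizon M e \<phi> v)\<^sup>2)"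
  proof (rule set_integrable_pointwise_limit[where g = "\<lambda>k v. v ^ n * (a (u0 - real k) v)\<^sup>2"])
    show "continuous_on {1..} (\<lambda>v. v ^ n * (a (u0 - real k) v)\<^sup>2)" for k
      unfolding a_def by (intro continuous_intros cont_v R_int_continuous) (use u0 in auto)
    show "continuous_on {1..} (\<lambda>v. v ^ n * (rp * dv_horizon M e \<phi> v)\<^sup>2)"
      by (intro continuous_intros dv_horizon_continuous)
    show "integral {1..V} (\<lambda>v. v ^ n * (a (u0 - real k) v)\<^sup>2) \<le> C" if "V \<ge> 1" for k V
      using C that by simp
    show "0 \<le> v ^ n * (a (u0 - real k) v)\<^sup>2" if "v \<ge> 1" for k v using that by simp
    fix v :: real assume v: "v \<ge> 1"
    have "filterlim (\<lambda>k. u0 + - real k) at_bot sequentially"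
      by (intro filterlim_tendsto_add_at_bot_iff[THEN iffD2, OF tendsto_const]
          filterlim_compose[OF filterlim_uminus_at_bot_at_top filterlim_real_sequentially])
    then have lim: "filterlim (\<lambda>k. u0 - real k) at_bot sequentially" by simp
    have "filterlim (\<lambda>u. v + u) at_bot at_bot"
      by (intro filterlim_tendsto_add_at_bot_iff[THEN iffD2, OF tendsto_const] filterlim_ident)
    then have "((\<lambda>u. R_int (v + u)) \<longlongrightarrow> rp) at_bot"
      by (rule filterlim_compose[OF R_int_tendsto])
    then have "((\<lambda>u. a u v) \<longlongrightarrow> rp * dv_horizon M e \<phi> v) at_bot"
      unfolding a_def dv_horizon_eq[OF v] by (intro tendsto_intros pd_v_in_int_tendsto v)
    from filterlim_compose[OF this lim]
    show "(\<lambda>k. v ^ n * (a (u0 - real k) v)\<^sup>2) \<longlonglongrightarrow> v ^ n * (rp * dv_horizon M e \<phi> v)\<^sup>2"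
      by (intro tendsto_intros)
  qed
  then have "set_integrable lborel {1..} (\<lambda>v. rp\<^sup>2 * (v ^ n * (dv_horizon M e \<phi> v)\<^sup>2))"
    by (simp add: power_mult_distrib mult_ac)
  then show ?thesis
    using horizons by (simp add: set_integrable_mult_right_iff)
qed

end

end

theorem theorem1p10:
  fixes M e U0 D u :: real and \<alpha>\<^sub>0 :: nat and \<phi> :: "real \<times> real \<Rightarrow> real"
  assumes "0 < \<bar>e\<bar>" and "\<bar>e\<bar> < M" and "U0 > 0" and "D > 0"
    and "spherical_wave_solution M e U0 \<phi>"
    and "data_bounds M e U0 D \<phi>"
    and "limit_condition M e U0 \<phi>"
    and "u \<le> -1" and "\<alpha>\<^sub>0 > 0"
    and "set_integrable lborel {1..}
           (\<lambda>v. (ln (1 / Omega_int M e u v)) ^ \<alpha>\<^sub>0 * (pd_v (in_int M e \<phi>) u v)\<^sup>2)"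
  shows "set_integrable lborel {1..}
           (\<lambda>v. v ^ \<alpha>\<^sub>0 / (ln (1 + v))\<^sup>2 * (dv_horizon M e \<phi> v)\<^sup>2)"
proof -
  interpret subextremal M e by unfold_locales (use assms in auto)
  have wave: "wave_eq {..-1} (r_int M e) (in_int M e \<phi>)" and "C1_on (rn_region M e U0) \<phi>"
    using assms(5) by (auto simp: spherical_wave_solution_def)
  then obtain \<phi>' :: "real \<times> real \<Rightarrow> (real \<times> real) \<Rightarrow>\<^sub>L real" where \<phi>':
    "\<And>x. x \<in> rn_region M e U0 \<Longrightarrow> (\<phi> has_derivative \<phi>' x) (at x within rn_region M e U0)"
    "continuous_on (rn_region M e U0) \<phi>'"
    by (auto simp: C1_on_def)
  have data: "\<bar>pd_u {..-1} (in_int M e \<phi>) u 1 / pd_u {..-1} (r_int M e) u 1\<bar> \<le> D" if "u \<le> -1" for u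
    using assms(6) that by (simp add: data_bounds_def Let_def)
  have int: "set_integrable lborel {1..} (\<lambda>v. v ^ \<alpha>\<^sub>0 * (dv_horizon M e \<phi> v)\<^sup>2)"
    by (rule horizon_weighted_integrable[OF \<phi>' wave data assms(8,10)])
  have cont: "continuous_on {1..} (dv_horizon M e \<phi>)"
    by (rule dv_horizon_continuous[OF \<phi>'])
  \<comment> \<open>For \<open>v \<ge> 1\<close> one has \<open>ln (1 + v) \<ge> ln 2\<close>, so
    this function dominates the integrand with the logarithmic weight.\<close>
  have "set_integrable lborel {1..} (\<lambda>v. 1 / (ln 2)\<^sup>2 * (v ^ \<alpha>\<^sub>0 * (dv_horizon M e \<phi> v)\<^sup>2))"
    by (rule set_integrable_mult_right[OF int])
  then show ?thesis
  proof (rule set_integrable_bound)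
    have "continuous_on {1..} (\<lambda>v. v ^ \<alpha>\<^sub>0 / (ln (1 + v))\<^sup>2 * (dv_horizon M e \<phi> v)\<^sup>2)"
      by (intro continuous_intros cont) auto
    from borel_measurable_continuous_on_indicator[OF _ this]
    show "set_borel_measurable lborel {1..} (\<lambda>v. v ^ \<alpha>\<^sub>0 / (ln (1 + v))\<^sup>2 * (dv_horizon M e \<phi> v)\<^sup>2)"
      by (simp add: set_borel_measurable_def)
    have "norm (v ^ \<alpha>\<^sub>0 / (ln (1 + v))\<^sup>2 * (dv_horizon M e \<phi> v)\<^sup>2)
        \<le> norm (1 / (ln 2)\<^sup>2 * (v ^ \<alpha>\<^sub>0 * (dv_horizon M e \<phi> v)\<^sup>2))" if "v \<ge> 1" for v
    proof -
      have "(ln 2)\<^sup>2 \<le> (ln (1 + v))\<^sup>2" using that by (intro power_mono) auto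
      then have "v ^ \<alpha>\<^sub>0 / (ln (1 + v))\<^sup>2 * (dv_horizon M e \<phi> v)\<^sup>2 \<le> v ^ \<alpha>\<^sub>0 / (ln 2)\<^sup>2 * (dv_horizon M e \<phi> v)\<^sup>2"
        using that by (intro mult_right_mono divide_left_mono) auto
      then show ?thesis using that by simp
    qed
    then show "AE v in lborel. v \<in> {1..} \<longrightarrow> norm (v ^ \<alpha>\<^sub>0 / (ln (1 + v))\<^sup>2 * (dv_horizon M e \<phi> v)\<^sup>2)
        \<le> norm (1 / (ln 2)\<^sup>2 * (v ^ \<alpha>\<^sub>0 * (dv_horizon M e \<phi> v)\<^sup>2))"
      by auto
  qed
qed

end
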